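(* Let $\mathcal{A}$ be the category of finite-dimensional $C^*$-algebras and centre-preserving unital $*$-homomorphisms, $\mathbf{H}_{\mathrm{sm}}$ the smooth $\infty$-topos, and $\mathbf{H}_{\mathbb{Q}} := \mathrm{Fun}(\mathcal{A}, \mathbf{H}_{\mathrm{sm}})$ with Day convolution $\otimes$. For $A\in\mathcal{A}$ let $\mathbf{y}_A\in\mathbf{H}_{\mathbb{Q}}$ be the representable functor. There is no natural transformation $c:\mathbf{y}_{(-)}\Rightarrow\mathbf{y}_{(-)}\otimes\mathbf{y}_{(-)}$ in $\mathbf{H}_{\mathbb{Q}}$; that is, there is no family of morphisms $c_A:\mathbf{y}_A\to\mathbf{y}_A\otimes\mathbf{y}_A$ ($A\in\mathcal{A}$) such that for every morphism $f:A\to B$ of $\mathcal{A}$ one has, up to homotopy, $(\mathbf{y}_f\otimes\mathbf{y}_f)\circ c_B = c_A\circ\mathbf{y}_f$ as morphisms $\mathbf{y}_B\to\mathbf{y}_A\otimes\mathbf{y}_A$.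
   Context: All notions are $\infty$-categorical; functors in $\mathrm{Fun}$ are covariant. $\mathcal{A}$ is the (essentially small) category whose objects are finite-dimensional $C^*$-algebras and whose morphisms are the unital $*$-homomorphisms $f:A\to B$ with $f(Z(A))\subseteq Z(B)$, where $Z(-)$ is the centre; it is regarded as an $\infty$-category via its nerve. It is symmetric monoidal under the (minimal) tensor product of $C^*$-algebras with unit $\mathbb{C}$. $\mathbf{H}_{\mathrm{sm}}$ is the $\infty$-topos of sheaves of spaces on the essentially small category of smooth manifolds that are finite disjoint unions of open balls, with the open cover topology; $*$ is its terminal object. Representables: $\mathbf{y}_A(B)=\mathrm{Hom}_{\mathcal{A}}(A,B)\cdot *$ (copower of the set $\mathrm{Hom}_{\mathcal{A}}(A,B)$ with $*$). A morphism $f:A\to B$ of $\mathcal{A}$ induces $\mathbf{y}_f:\mathbf{y}_B\to\mathbf{y}_A$ by precomposition, $h\mapsto h\circ f$. The tensor product on $\mathbf{H}_{\mathbb{Q}}$ is Day convolution: $(F\otimes G)(A)=\int^{B,C\in\mathcal{A}}\mathrm{Hom}_{\mathcal{A}}(B\otimes C,A)\times F(B)\times G(C)$; in particular $\mathbf{y}_A\otimes\mathbf{y}_B\cong\mathbf{y}_{A\otimes B}$. *)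

theory Defs
  imports "HOL-Analysis.Analysis"
begin

section \<open>Categories, functors and localizations\<close>

datatype ('o, 'h) arr = Arr (src: 'o) (fn: 'h) (tgt: 'o)

definition flip :: "('o, 'h) arr \<Rightarrow> ('o, 'h) arr" where
  "flip a = Arr (tgt a) (fn a) (src a)"

record ('o, 'h) cat =
  Ob :: "'o set"
  Ar :: "('o, 'h) arr set"
  Ide :: "'o \<Rightarrow> ('o, 'h) arr"
  Comp :: "('o, 'h) arr \<Rightarrow> ('o, 'h) arr \<Rightarrow> ('o, 'h) arr"

definition hom :: "('o, 'h) cat \<Rightarrow> 'o \<Rightarrow> 'o \<Rightarrow> ('o, 'h) arr set" where
  "hom C X Y = {a \<in> Ar C. src a = X \<and> tgt a = Y}"

definition opp :: "('o, 'h) cat \<Rightarrow> ('o, 'h) cat" where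
  "opp C = \<lparr>Ob = Ob C, Ar = flip ` Ar C, Ide = (\<lambda>X. flip (Ide C X)),
            Comp = (\<lambda>g f. flip (Comp C (flip f) (flip g)))\<rparr>"

text \<open>Objects with underlying sets, arrows being certain extensional functions between these.\<close>

definition concrete_cat ::
    "'o set \<Rightarrow> ('o \<Rightarrow> 'a set) \<Rightarrow> ('o \<Rightarrow> 'o \<Rightarrow> ('a \<Rightarrow> 'a) set) \<Rightarrow> ('o, 'a \<Rightarrow> 'a) cat" where
  "concrete_cat Obs U H =
     \<lparr>Ob = Obs,
      Ar = {Arr X f Y | X f Y. X \<in> Obs \<and> Y \<in> Obs \<and> f \<in> H X Y \<and> f \<in> U X \<rightarrow>\<^sub>E U Y},
      Ide = (\<lambda>X. Arr X (\<lambda>x\<in>U X. x) X),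
      Comp = (\<lambda>g f. Arr (src f) (compose (U (src f)) (fn g) (fn f)) (tgt g))\<rparr>"

datatype ('o1, 'h1, 'o2, 'h2) func =
  Func (obj_of: "'o1 \<Rightarrow> 'o2") (arr_of: "('o1, 'h1) arr \<Rightarrow> ('o2, 'h2) arr")

definition is_functor ::
    "('o1, 'h1) cat \<Rightarrow> ('o2, 'h2) cat \<Rightarrow> ('o1, 'h1, 'o2, 'h2) func \<Rightarrow> bool" where
  "is_functor C D F \<longleftrightarrow>
     (\<forall>X\<in>Ob C. obj_of F X \<in> Ob D \<and> arr_of F (Ide C X) = Ide D (obj_of F X)) \<and>
     (\<forall>a\<in>Ar C. arr_of F a \<in> hom D (obj_of F (src a)) (obj_of F (tgt a))) \<and>
     (\<forall>a\<in>Ar C. \<forall>b\<in>Ar C. tgt a = src b \<longrightarrow>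
        arr_of F (Comp C b a) = Comp D (arr_of F b) (arr_of F a))"

text \<open>
  Functors agreeing on all objects and arrows of \<open>C\<close> but differing as HOL functions elsewhere
  are isomorphic (not equal) objects of \<open>Fun C D\<close>. Natural transformations are extensional.
\<close>

definition Fun ::
    "('o1, 'h1) cat \<Rightarrow> ('o2, 'h2) cat \<Rightarrow>
     (('o1, 'h1, 'o2, 'h2) func, 'o1 \<Rightarrow> ('o2, 'h2) arr) cat" where
  "Fun C D =
     \<lparr>Ob = {F. is_functor C D F},
      Ar = {Arr F t G | F t G. is_functor C D F \<and> is_functor C D G \<and>
              t \<in> (\<Pi>\<^sub>E X\<in>Ob C. hom D (obj_of F X) (obj_of G X)) \<and>
              (\<forall>a\<in>Ar C. Comp D (t (tgt a)) (arr_of F a) = Comp D (arr_of G a) (t (src a)))},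
      Ide = (\<lambda>F. Arr F (\<lambda>X\<in>Ob C. Ide D (obj_of F X)) F),
      Comp = (\<lambda>s t. Arr (src t) (\<lambda>X\<in>Ob C. Comp D (fn s X) (fn t X)) (tgt s))\<rparr>"

text \<open>
  Gabriel-Zisman localization \<open>C[W\<^sup>-\<^sup>1]\<close>: arrows are classes of zigzags, read from left to right,
  in which the arrows of \<open>W\<close> may also be traversed backwards.
\<close>

datatype ('o, 'h) step = Fwd "('o, 'h) arr" | Bwd "('o, 'h) arr"

fun zigzag :: "('o, 'h) cat \<Rightarrow> ('o, 'h) arr set \<Rightarrow> 'o \<Rightarrow> ('o, 'h) step list \<Rightarrow> 'o \<Rightarrow> bool" where
  "zigzag C W X [] Y \<longleftrightarrow> X \<in> Ob C \<and> X = Y"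
| "zigzag C W X (Fwd a # p) Y \<longleftrightarrow> a \<in> Ar C \<and> src a = X \<and> zigzag C W (tgt a) p Y"
| "zigzag C W X (Bwd a # p) Y \<longleftrightarrow> a \<in> Ar C \<inter> W \<and> tgt a = X \<and> zigzag C W (src a) p Y"

definition zz_relations ::
    "('o, 'h) cat \<Rightarrow> ('o, 'h) arr set \<Rightarrow> (('o, 'h) step list \<times> ('o, 'h) step list) set" where
  "zz_relations C W =
     {([Fwd (Ide C X)], []) | X. X \<in> Ob C} \<union>
     {([Fwd a, Fwd b], [Fwd (Comp C b a)]) | a b. a \<in> Ar C \<and> b \<in> Ar C \<and> tgt a = src b} \<union>
     {([Fwd a, Bwd a], []) | a. a \<in> Ar C \<inter> W} \<union>
     {([Bwd a, Fwd a], []) | a. a \<in> Ar C \<inter> W}"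

definition zz_class ::
    "('o, 'h) cat \<Rightarrow> ('o, 'h) arr set \<Rightarrow> 'o \<Rightarrow> 'o \<Rightarrow> ('o, 'h) step list \<Rightarrow> ('o, 'h) step list set" where
  "zz_class C W X Y p =
     {q. equivclp (\<lambda>p q. \<exists>r l l' s. p = r @ l @ s \<and> q = r @ l' @ s \<and> (l, l') \<in> zz_relations C W \<and>
            zigzag C W X p Y \<and> zigzag C W X q Y) p q}"

definition localization ::
    "('o, 'h) cat \<Rightarrow> ('o, 'h) arr set \<Rightarrow> ('o, ('o, 'h) step list set) cat" where
  "localization C W =
     \<lparr>Ob = Ob C,
      Ar = {Arr X (zz_class C W X Y p) Y | X p Y. zigzag C W X p Y},
      Ide = (\<lambda>X. Arr X (zz_class C W X X []) X),
      Comp = (\<lambda>b a. Arr (src a)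
                (\<Union>p\<in>fn a. \<Union>q\<in>fn b. zz_class C W (src a) (tgt b) (p @ q)) (tgt b))\<rparr>"

definition loc_arr ::
    "('o, 'h) cat \<Rightarrow> ('o, 'h) arr set \<Rightarrow> ('o, 'h) arr \<Rightarrow> ('o, ('o, 'h) step list set) arr" where
  "loc_arr C W a = Arr (src a) (zz_class C W (src a) (tgt a) [Fwd a]) (tgt a)"


section \<open>Finite-dimensional C*-algebras\<close>

text \<open>
  Up to isomorphism the underlying vector space is \<open>\<complex>\<^sup>d\<close>, realized as the functions
  \<^typ>\<open>nat \<Rightarrow> complex\<close> vanishing outside \<open>{..<d}\<close>; this is the small model of the category.
  The operations are only relevant on these vectors. The zero algebra (\<open>d = 0\<close>) is included.
\<close>

record fd_alg =
  adim :: nat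
  mul :: "(nat \<Rightarrow> complex) \<Rightarrow> (nat \<Rightarrow> complex) \<Rightarrow> nat \<Rightarrow> complex"
  star :: "(nat \<Rightarrow> complex) \<Rightarrow> nat \<Rightarrow> complex"
  one :: "nat \<Rightarrow> complex"
  nrm :: "(nat \<Rightarrow> complex) \<Rightarrow> real"

definition vecs :: "fd_alg \<Rightarrow> (nat \<Rightarrow> complex) set" where
  "vecs A = {x. \<forall>i\<ge>adim A. x i = 0}"

definition basis :: "nat \<Rightarrow> nat \<Rightarrow> complex" where
  "basis i = (\<lambda>j. if j = i then 1 else 0)"

definition is_star_algebra :: "fd_alg \<Rightarrow> bool" where
  "is_star_algebra A \<longleftrightarrow>
     one A \<in> vecs A \<and>
     (\<forall>x\<in>vecs A. star A x \<in> vecs A \<and> star A (star A x) = x \<and>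
        mul A (one A) x = x \<and> mul A x (one A) = x) \<and>
     (\<forall>x\<in>vecs A. \<forall>y\<in>vecs A. mul A x y \<in> vecs A \<and>
        star A (mul A x y) = mul A (star A y) (star A x) \<and>
        star A (\<lambda>i. x i + y i) = (\<lambda>i. star A x i + star A y i) \<and>
        (\<forall>a. star A (\<lambda>i. a * x i) = (\<lambda>i. cnj a * star A x i) \<and>
             mul A (\<lambda>i. a * x i) y = (\<lambda>i. a * mul A x y i) \<and>
             mul A x (\<lambda>i. a * y i) = (\<lambda>i. a * mul A x y i))) \<and>
     (\<forall>x\<in>vecs A. \<forall>y\<in>vecs A. \<forall>z\<in>vecs A.
        mul A (mul A x y) z = mul A x (mul A y z) \<and>
        mul A (\<lambda>i. x i + y i) z = (\<lambda>i. mul A x z i + mul A y z i) \<and>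
        mul A z (\<lambda>i. x i + y i) = (\<lambda>i. mul A z x i + mul A z y i))"

text \<open>Completeness is automatic in finite dimension.\<close>

definition cstar_norm :: "fd_alg \<Rightarrow> ((nat \<Rightarrow> complex) \<Rightarrow> real) \<Rightarrow> bool" where
  "cstar_norm A N \<longleftrightarrow>
     (\<forall>x\<in>vecs A. 0 \<le> N x \<and> (N x = 0 \<longrightarrow> x = (\<lambda>_. 0)) \<and>
        N (mul A (star A x) x) = (N x)\<^sup>2 \<and> (\<forall>a. N (\<lambda>i. a * x i) = cmod a * N x)) \<and>
     (\<forall>x\<in>vecs A. \<forall>y\<in>vecs A. N (\<lambda>i. x i + y i) \<le> N x + N y \<and> N (mul A x y) \<le> N x * N y)"

definition centre :: "fd_alg \<Rightarrow> (nat \<Rightarrow> complex) set" where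
  "centre A = {z \<in> vecs A. \<forall>x\<in>vecs A. mul A z x = mul A x z}"

definition star_homs :: "fd_alg \<Rightarrow> fd_alg \<Rightarrow> ((nat \<Rightarrow> complex) \<Rightarrow> nat \<Rightarrow> complex) set" where
  "star_homs A B = {f \<in> vecs A \<rightarrow> vecs B.
     f (one A) = one B \<and>
     (\<forall>x\<in>vecs A. f (star A x) = star B (f x) \<and> (\<forall>a. f (\<lambda>i. a * x i) = (\<lambda>i. a * f x i))) \<and>
     (\<forall>x\<in>vecs A. \<forall>y\<in>vecs A. f (mul A x y) = mul B (f x) (f y) \<and>
        f (\<lambda>i. x i + y i) = (\<lambda>i. f x i + f y i))}"

type_synonym alg_arr = "(fd_alg, (nat \<Rightarrow> complex) \<Rightarrow> nat \<Rightarrow> complex) arr"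

definition Alg :: "(fd_alg, (nat \<Rightarrow> complex) \<Rightarrow> nat \<Rightarrow> complex) cat" where
  "Alg = concrete_cat {A. is_star_algebra A \<and> cstar_norm A (nrm A)} vecs
           (\<lambda>A B. {f \<in> star_homs A B. f ` centre A \<subseteq> centre B})"

text \<open>
  The basis vector \<open>e\<^sub>i \<otimes> e\<^sub>j\<close> of \<open>\<complex>\<^sup>d \<otimes> \<complex>\<^sup>e\<close> has index \<open>i * e + j\<close>.
  The minimal C*-norm is the least one on the algebraic tensor product.
\<close>

definition tensor_vec :: "nat \<Rightarrow> nat \<Rightarrow> (nat \<Rightarrow> complex) \<Rightarrow> (nat \<Rightarrow> complex) \<Rightarrow> nat \<Rightarrow> complex" where
  "tensor_vec d e x y = (\<lambda>p. if p < d * e then x (p div e) * y (p mod e) else 0)"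

definition alg_tensor :: "fd_alg \<Rightarrow> fd_alg \<Rightarrow> fd_alg" where
  "alg_tensor A B = (let d = adim A; e = adim B in
     \<lparr>adim = d * e,
      mul = (\<lambda>x y p. \<Sum>i<d. \<Sum>j<e. \<Sum>k<d. \<Sum>l<e. x (i * e + j) * y (k * e + l) *
               tensor_vec d e (mul A (basis i) (basis k)) (mul B (basis j) (basis l)) p),
      star = (\<lambda>x p. \<Sum>i<d. \<Sum>j<e. cnj (x (i * e + j)) *
               tensor_vec d e (star A (basis i)) (star B (basis j)) p),
      one = tensor_vec d e (one A) (one B),
      nrm = (\<lambda>_. 0)\<rparr>)"

definition tensor :: "fd_alg \<Rightarrow> fd_alg \<Rightarrow> fd_alg" where
  "tensor A B = (alg_tensor A B)
     \<lparr>nrm := (\<lambda>x. Inf {N x | N. cstar_norm (alg_tensor A B) N})\<rparr>"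

definition tensor_arr :: "alg_arr \<Rightarrow> alg_arr \<Rightarrow> alg_arr" where
  "tensor_arr f g = Arr (tensor (src f) (src g))
     (\<lambda>x\<in>vecs (tensor (src f) (src g)).
        \<lambda>p. \<Sum>i<adim (src f). \<Sum>j<adim (src g). x (i * adim (src g) + j) *
          tensor_vec (adim (tgt f)) (adim (tgt g)) (fn f (basis i)) (fn g (basis j)) p)
     (tensor (tgt f) (tgt g))"


section \<open>The site of finite disjoint unions of open balls\<close>

definition unit_ball :: "nat \<Rightarrow> (nat \<Rightarrow> real) set" where
  "unit_ball n = {x \<in> topspace (Euclidean_space n). (\<Sum>i<n. (x i)\<^sup>2) < 1}"

text \<open>\<open>C_diff k n S f\<close>: the function \<open>f\<close> is of class \<open>C\<^sup>k\<close> on the open set \<open>S\<close> of \<open>\<real>\<^sup>n\<close>.\<close>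

fun C_diff :: "nat \<Rightarrow> nat \<Rightarrow> (nat \<Rightarrow> real) set \<Rightarrow> ((nat \<Rightarrow> real) \<Rightarrow> real) \<Rightarrow> bool" where
  "C_diff 0 n S f \<longleftrightarrow> continuous_map (subtopology (Euclidean_space n) S) euclideanreal f"
| "C_diff (Suc k) n S f \<longleftrightarrow> (\<forall>i<n. \<exists>g. C_diff k n S g \<and>
     (\<forall>x\<in>S. ((\<lambda>t. f (x(i := t))) has_real_derivative g x) (at (x i))))"

definition smooth :: "nat \<Rightarrow> nat \<Rightarrow> (nat \<Rightarrow> real) set \<Rightarrow> ((nat \<Rightarrow> real) \<Rightarrow> nat \<Rightarrow> real) \<Rightarrow> bool" where
  "smooth n m S f \<longleftrightarrow> (\<forall>j<m. \<forall>k. C_diff k n S (\<lambda>x. f x j))"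

text \<open>
  The list \<open>[n\<^sub>1, \<dots>, n\<^sub>k]\<close> denotes the disjoint union of the open unit balls of
  \<open>\<real>\<^bsup>n\<^sub>1\<^esup>, \<dots>, \<real>\<^bsup>n\<^sub>k\<^esup>\<close>; every open ball is diffeomorphic to a unit ball.
  Balls are connected, so each one is mapped into a single component.
\<close>

type_synonym mfd = "nat list"
type_synonym point = "nat \<times> (nat \<Rightarrow> real)"

definition points :: "mfd \<Rightarrow> point set" where
  "points M = (SIGMA i:{..<length M}. unit_ball (M ! i))"

definition smooth_maps :: "mfd \<Rightarrow> mfd \<Rightarrow> (point \<Rightarrow> point) set" where
  "smooth_maps M N = {f \<in> points M \<rightarrow> points N. \<forall>i<length M. \<exists>j<length N.
     (\<forall>x\<in>unit_ball (M ! i). fst (f (i, x)) = j) \<and>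
     smooth (M ! i) (N ! j) (unit_ball (M ! i)) (\<lambda>x. snd (f (i, x)))}"

definition Site :: "(mfd, point \<Rightarrow> point) cat" where
  "Site = concrete_cat UNIV points smooth_maps"

text \<open>Injective, and a diffeomorphism of each component onto an open subset of its target ball.\<close>

definition open_embedding :: "(mfd, point \<Rightarrow> point) arr \<Rightarrow> bool" where
  "open_embedding a \<longleftrightarrow> a \<in> Ar Site \<and> inj_on (fn a) (points (src a)) \<and>
     (\<forall>i<length (src a). \<exists>j<length (tgt a).
        let B = unit_ball (src a ! i); S = (\<lambda>x. snd (fn a (i, x))) ` B in
        (\<forall>x\<in>B. fst (fn a (i, x)) = j) \<and> openin (Euclidean_space (tgt a ! j)) S \<and>
        (\<exists>g. (\<forall>x\<in>B. g (snd (fn a (i, x))) = x) \<and> smooth (tgt a ! j) (src a ! i) S g))"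

definition sieve :: "mfd \<Rightarrow> (mfd, point \<Rightarrow> point) arr set \<Rightarrow> bool" where
  "sieve U R \<longleftrightarrow> R \<subseteq> {a \<in> Ar Site. tgt a = U} \<and>
     (\<forall>a\<in>R. \<forall>b\<in>Ar Site. tgt b = src a \<longrightarrow> Comp Site a b \<in> R)"

definition covering_sieve :: "mfd \<Rightarrow> (mfd, point \<Rightarrow> point) arr set \<Rightarrow> bool" where
  "covering_sieve U R \<longleftrightarrow> sieve U R \<and>
     (\<forall>p\<in>points U. \<exists>a\<in>R. open_embedding a \<and> p \<in> fn a ` points (src a))"


section \<open>Simplicial sets and simplicial presheaves\<close>

definition Simplex :: "(nat, nat \<Rightarrow> nat) cat" where
  "Simplex = concrete_cat UNIV (\<lambda>n. {..n}) (\<lambda>m n. {t. mono_on {..m} t})"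

text \<open>
  The universe of elements of simplices. The constructors \<open>SiteArr\<close>, \<open>AlgArr\<close>, \<open>Pr\<close> and \<open>Bar\<close>
  encode representables, products and bar constructions. The constructor \<open>Family\<close> makes the
  universe closed under families indexed by the continuum, hence large enough for fibrant
  replacements and sheafifications on the above site.
\<close>

datatype elt =
    SiteArr (the_site: "(mfd, point \<Rightarrow> point) arr")
  | AlgArr (the_alg: alg_arr)
  | Pr (p1: elt) (p2: elt)
  | Bar "nat \<Rightarrow> nat \<Rightarrow> alg_arr" "nat \<Rightarrow> nat \<Rightarrow> alg_arr" alg_arr elt elt
  | Family "real \<Rightarrow> elt"

definition SetCat :: "(elt set, elt \<Rightarrow> elt) cat" where
  "SetCat = concrete_cat UNIV (\<lambda>S. S) (\<lambda>S T. UNIV)"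

type_synonym sset = "(nat, nat \<Rightarrow> nat, elt set, elt \<Rightarrow> elt) func"
type_synonym sset_arr = "(sset, nat \<Rightarrow> (elt set, elt \<Rightarrow> elt) arr) arr"
type_synonym spsh = "(mfd, point \<Rightarrow> point, sset, nat \<Rightarrow> (elt set, elt \<Rightarrow> elt) arr) func"
type_synonym spsh_arr = "(spsh, mfd \<Rightarrow> sset_arr) arr"
type_synonym hq = "(fd_alg, (nat \<Rightarrow> complex) \<Rightarrow> nat \<Rightarrow> complex, spsh, mfd \<Rightarrow> sset_arr) func"
type_synonym hq_arr = "(hq, fd_alg \<Rightarrow> spsh_arr) arr"

definition sSet :: "(sset, nat \<Rightarrow> (elt set, elt \<Rightarrow> elt) arr) cat" where
  "sSet = Fun (opp Simplex) SetCat"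

definition sPSh :: "(spsh, mfd \<Rightarrow> sset_arr) cat" where
  "sPSh = Fun (opp Site) sSet"

text \<open>Restriction of simplices along \<open>t : [m] \<rightarrow> [n]\<close>, and of sections along a map of manifolds.\<close>

definition simp_act :: "sset \<Rightarrow> (nat, nat \<Rightarrow> nat) arr \<Rightarrow> elt \<Rightarrow> elt" where
  "simp_act X t = fn (arr_of X (flip t))"

definition site_act :: "spsh \<Rightarrow> (mfd, point \<Rightarrow> point) arr \<Rightarrow> nat \<Rightarrow> elt \<Rightarrow> elt" where
  "site_act P a n = fn (fn (arr_of P (flip a)) n)"

text \<open>Simplicial sets, simplicial presheaves and maps between them from their raw data.\<close>

definition mk_sset :: "(nat \<Rightarrow> elt set) \<Rightarrow> ((nat, nat \<Rightarrow> nat) arr \<Rightarrow> elt \<Rightarrow> elt) \<Rightarrow> sset" where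
  "mk_sset S d = Func S
     (\<lambda>a. Arr (S (src a)) (restrict (d (flip a)) (S (src a))) (S (tgt a)))"

definition mk_sset_map :: "sset \<Rightarrow> sset \<Rightarrow> (nat \<Rightarrow> elt \<Rightarrow> elt) \<Rightarrow> sset_arr" where
  "mk_sset_map X Y f =
     Arr X (\<lambda>n. Arr (obj_of X n) (restrict (f n) (obj_of X n)) (obj_of Y n)) Y"

definition mk_spsh ::
    "(mfd \<Rightarrow> nat \<Rightarrow> elt set) \<Rightarrow> ((mfd, point \<Rightarrow> point) arr \<Rightarrow> nat \<Rightarrow> elt \<Rightarrow> elt) \<Rightarrow>
     (mfd \<Rightarrow> (nat, nat \<Rightarrow> nat) arr \<Rightarrow> elt \<Rightarrow> elt) \<Rightarrow> spsh" where
  "mk_spsh S m d = (let P = (\<lambda>U. mk_sset (S U) (d U)) in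
     Func P (\<lambda>a. mk_sset_map (P (src a)) (P (tgt a)) (m (flip a))))"

definition mk_spsh_map :: "spsh \<Rightarrow> spsh \<Rightarrow> (mfd \<Rightarrow> nat \<Rightarrow> elt \<Rightarrow> elt) \<Rightarrow> spsh_arr" where
  "mk_spsh_map P Q f = Arr P (\<lambda>U. mk_sset_map (obj_of P U) (obj_of Q U) (f U)) Q"

text \<open>\<open>coface n i : [n] \<rightarrow> [n + 1]\<close> omits the value \<open>i\<close>.\<close>

definition coface :: "nat \<Rightarrow> nat \<Rightarrow> (nat, nat \<Rightarrow> nat) arr" where
  "coface n i = Arr n (\<lambda>j\<in>{..n}. if j < i then j else Suc j) (Suc n)"

text \<open>The horn-filling condition; a horn is a compatible family of all faces but the \<open>k\<close>-th.\<close>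

definition Kan :: "sset \<Rightarrow> bool" where
  "Kan X \<longleftrightarrow> X \<in> Ob sSet \<and>
     (\<forall>n k z. k \<le> Suc n \<longrightarrow> (\<forall>i\<le>Suc n. i \<noteq> k \<longrightarrow> z i \<in> obj_of X n) \<longrightarrow>
        (\<forall>m i j. n = Suc m \<and> i < j \<and> j \<le> Suc n \<and> i \<noteq> k \<and> j \<noteq> k \<longrightarrow>
           simp_act X (coface m i) (z j) = simp_act X (coface m (j - 1)) (z i)) \<longrightarrow>
        (\<exists>w\<in>obj_of X (Suc n). \<forall>i\<le>Suc n. i \<noteq> k \<longrightarrow> simp_act X (coface n i) w = z i))"

text \<open>A homotopy \<open>X \<times> \<Delta>\<^sup>1 \<rightarrow> Z\<close> sends \<open>(s, x)\<close> with \<open>s : [n] \<rightarrow> [1]\<close> and \<open>x \<in> X\<^sub>n\<close> to \<open>H s x \<in> Z\<^sub>n\<close>.\<close>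

definition homotopic :: "sset_arr \<Rightarrow> sset_arr \<Rightarrow> bool" where
  "homotopic f g \<longleftrightarrow> (let X = src f; Z = tgt f in
     src g = X \<and> tgt g = Z \<and>
     (\<exists>H. (\<forall>n. \<forall>s\<in>hom Simplex n 1. \<forall>x\<in>obj_of X n. H s x \<in> obj_of Z n \<and>
              (\<forall>t\<in>Ar Simplex. tgt t = n \<longrightarrow>
                 H (Comp Simplex s t) (simp_act X t x) = simp_act Z t (H s x))) \<and>
          (\<forall>n. \<forall>x\<in>obj_of X n. H (Arr n (\<lambda>_\<in>{..n}. 0) 1) x = fn (fn f n) x \<and>
                                H (Arr n (\<lambda>_\<in>{..n}. 1) 1) x = fn (fn g n) x)))"

text \<open>Bijectivity of \<open>\<pi>\<^sub>0 Map(Y, Z) \<rightarrow> \<pi>\<^sub>0 Map(X, Z)\<close> for all Kan complexes \<open>Z\<close>.\<close>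

definition weak_eq :: "sset_arr \<Rightarrow> bool" where
  "weak_eq f \<longleftrightarrow> f \<in> Ar sSet \<and> (\<forall>Z. Kan Z \<longrightarrow>
     (\<forall>h\<in>hom sSet (src f) Z. \<exists>g\<in>hom sSet (tgt f) Z. homotopic (Comp sSet g f) h) \<and>
     (\<forall>g\<in>hom sSet (tgt f) Z. \<forall>g'\<in>hom sSet (tgt f) Z.
        homotopic (Comp sSet g f) (Comp sSet g' f) \<longrightarrow> homotopic g g'))"


section \<open>The smooth infinity-topos\<close>

text \<open>The homotopy category of the infinity-category of presheaves of spaces on the site.\<close>

definition psh_weq :: "spsh_arr set" where
  "psh_weq = {f \<in> Ar sPSh. \<forall>U\<in>Ob Site. weak_eq (fn f U)}"

definition HoPSh :: "(spsh, (spsh, mfd \<Rightarrow> sset_arr) step list set) cat" where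
  "HoPSh = localization sPSh psh_weq"

definition psh_times :: "spsh \<Rightarrow> sset \<Rightarrow> spsh" where
  "psh_times P K = mk_spsh
     (\<lambda>U n. {Pr x k | x k. x \<in> obj_of (obj_of P U) n \<and> k \<in> obj_of K n})
     (\<lambda>a n z. Pr (site_act P a n (p1 z)) (p2 z))
     (\<lambda>U t z. Pr (simp_act (obj_of P U) t (p1 z)) (simp_act K t (p2 z)))"

definition psh_times_map :: "spsh_arr \<Rightarrow> sset \<Rightarrow> spsh_arr" where
  "psh_times_map f K = mk_spsh_map (psh_times (src f) K) (psh_times (tgt f) K)
     (\<lambda>U n z. Pr (fn (fn (fn f U) n) (p1 z)) (p2 z))"

text \<open>
  \<open>f : P \<rightarrow> Q\<close> induces an equivalence of derived mapping spaces \<open>Map(Q, Z) \<rightarrow> Map(P, Z)\<close>, i.e.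
  an isomorphism between the functors on the homotopy category of spaces which they represent,
  \<open>K \<mapsto> [Q \<times> K, Z]\<close> and \<open>K \<mapsto> [P \<times> K, Z]\<close>.
\<close>

definition map_equivalence :: "spsh_arr \<Rightarrow> spsh \<Rightarrow> bool" where
  "map_equivalence f Z \<longleftrightarrow> (\<forall>K\<in>Ob sSet.
     bij_betw (\<lambda>h. Comp HoPSh h (loc_arr sPSh psh_weq (psh_times_map f K)))
       (hom HoPSh (psh_times (tgt f) K) Z) (hom HoPSh (psh_times (src f) K) Z))"

text \<open>The subpresheaf of the representable of \<open>U\<close> given by a sieve on \<open>U\<close>.\<close>

definition sieve_psh :: "(mfd, point \<Rightarrow> point) arr set \<Rightarrow> spsh" where
  "sieve_psh R = mk_spsh (\<lambda>V n. SiteArr ` {a \<in> R. src a = V})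
     (\<lambda>b n z. SiteArr (Comp Site (the_site z) b)) (\<lambda>V t z. z)"

definition sieve_inclusion :: "mfd \<Rightarrow> (mfd, point \<Rightarrow> point) arr set \<Rightarrow> spsh_arr" where
  "sieve_inclusion U R =
     mk_spsh_map (sieve_psh R) (sieve_psh {a \<in> Ar Site. tgt a = U}) (\<lambda>V n z. z)"

definition is_sheaf :: "spsh \<Rightarrow> bool" where
  "is_sheaf Z \<longleftrightarrow> Z \<in> Ob sPSh \<and>
     (\<forall>U\<in>Ob Site. \<forall>R. covering_sieve U R \<longrightarrow> map_equivalence (sieve_inclusion U R) Z)"

text \<open>The maps of presheaves which become equivalences after sheafification.\<close>

definition local_eq :: "spsh_arr set" where
  "local_eq = {f \<in> Ar sPSh. \<forall>Z. is_sheaf Z \<longrightarrow> map_equivalence f Z}"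


section \<open>Functors on C*-algebras with values in the smooth infinity-topos\<close>

text \<open>
  The infinity-topos of sheaves is the localization of \<open>sPSh\<close> at \<open>local_eq\<close>, and functors with
  values in it are the localization of \<open>sPSh\<close>-valued functors at the objectwise local
  equivalences. \<open>HQ\<close> is the homotopy category: its arrows are homotopy classes of morphisms,
  and a diagram commutes in it iff it commutes up to homotopy.
\<close>

definition HQpre :: "(hq, fd_alg \<Rightarrow> spsh_arr) cat" where
  "HQpre = Fun Alg sPSh"

definition HQ_weq :: "hq_arr set" where
  "HQ_weq = {f \<in> Ar HQpre. \<forall>A\<in>Ob Alg. fn f A \<in> local_eq}"

definition HQ :: "(hq, (hq, fd_alg \<Rightarrow> spsh_arr) step list set) cat" where
  "HQ = localization HQpre HQ_weq"

abbreviation HQ_arr :: "hq_arr \<Rightarrow> (hq, (hq, fd_alg \<Rightarrow> spsh_arr) step list set) arr" where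
  "HQ_arr \<equiv> loc_arr HQpre HQ_weq"

definition simplices :: "hq \<Rightarrow> fd_alg \<Rightarrow> mfd \<Rightarrow> nat \<Rightarrow> elt set" where
  "simplices F A U n = obj_of (obj_of (obj_of F A) U) n"

definition alg_act :: "hq \<Rightarrow> alg_arr \<Rightarrow> mfd \<Rightarrow> nat \<Rightarrow> elt \<Rightarrow> elt" where
  "alg_act F k U n = fn (fn (fn (arr_of F k) U) n)"

definition mk_hq ::
    "(fd_alg \<Rightarrow> mfd \<Rightarrow> nat \<Rightarrow> elt set) \<Rightarrow> (alg_arr \<Rightarrow> mfd \<Rightarrow> nat \<Rightarrow> elt \<Rightarrow> elt) \<Rightarrow>
     (fd_alg \<Rightarrow> (mfd, point \<Rightarrow> point) arr \<Rightarrow> nat \<Rightarrow> elt \<Rightarrow> elt) \<Rightarrow>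
     (fd_alg \<Rightarrow> mfd \<Rightarrow> (nat, nat \<Rightarrow> nat) arr \<Rightarrow> elt \<Rightarrow> elt) \<Rightarrow> hq" where
  "mk_hq S a m d = (let F = (\<lambda>A. mk_spsh (S A) (m A) (d A)) in
     Func F (\<lambda>k. mk_spsh_map (F (src k)) (F (tgt k)) (a k)))"

definition mk_hq_map :: "hq \<Rightarrow> hq \<Rightarrow> (fd_alg \<Rightarrow> mfd \<Rightarrow> nat \<Rightarrow> elt \<Rightarrow> elt) \<Rightarrow> hq_arr" where
  "mk_hq_map F G f = Arr F (\<lambda>A\<in>Ob Alg. mk_spsh_map (obj_of F A) (obj_of G A) (f A)) G"

text \<open>
  \<open>B \<mapsto> Hom(A, B) \<cdot> *\<close>: the copower of a set \<open>S\<close> with the terminal sheaf is the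
  sheafification of the constant presheaf \<open>S\<close>, which is isomorphic to it in the localization.
\<close>

definition yo :: "fd_alg \<Rightarrow> hq" where
  "yo A = mk_hq (\<lambda>B U n. AlgArr ` hom Alg A B)
     (\<lambda>k U n z. AlgArr (Comp Alg k (the_alg z))) (\<lambda>B a n z. z) (\<lambda>B U t z. z)"

definition yo_map :: "alg_arr \<Rightarrow> hq_arr" where
  "yo_map f = mk_hq_map (yo (tgt f)) (yo (src f))
     (\<lambda>B U n z. AlgArr (Comp Alg (the_alg z) f))"

text \<open>
  Day convolution. The infinity-categorical coend
  \<open>\<integral>\<^sup>B\<^sup>,\<^sup>C Hom(B \<otimes> C, A) \<times> F(B) \<times> G(C)\<close> is the diagonal of the two-sided bar construction: an
  \<open>n\<close>-simplex consists of chains \<open>B\<^sub>0 \<rightarrow> \<dots> \<rightarrow> B\<^sub>n\<close> and \<open>C\<^sub>0 \<rightarrow> \<dots> \<rightarrow> C\<^sub>n\<close> in \<open>Alg\<close>, an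
  arrow \<open>B\<^sub>n \<otimes> C\<^sub>n \<rightarrow> A\<close>, and \<open>n\<close>-simplices of \<open>F(B\<^sub>0)\<close> and \<open>G(C\<^sub>0)\<close>. It is formed sectionwise,
  since sheafification preserves colimits and finite products; it respects objectwise local
  equivalences. A chain is given by the arrows \<open>b i j : B\<^sub>i \<rightarrow> B\<^sub>j\<close> for \<open>i \<le> j \<le> n\<close>.
\<close>

definition vertex :: "(nat \<Rightarrow> nat \<Rightarrow> alg_arr) \<Rightarrow> nat \<Rightarrow> fd_alg" where
  "vertex b i = src (b i i)"

definition chains :: "nat \<Rightarrow> (nat \<Rightarrow> nat \<Rightarrow> alg_arr) set" where
  "chains n = {b.
     (\<forall>i j. i \<le> j \<and> j \<le> n \<longrightarrow> b i j \<in> hom Alg (vertex b i) (vertex b j)) \<and>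
     (\<forall>i\<le>n. b i i = Ide Alg (vertex b i)) \<and>
     (\<forall>i j k. i \<le> j \<and> j \<le> k \<and> k \<le> n \<longrightarrow> b i k = Comp Alg (b j k) (b i j)) \<and>
     (\<forall>i j. \<not> (i \<le> j \<and> j \<le> n) \<longrightarrow> b i j = undefined)}"

definition chain_act :: "(nat, nat \<Rightarrow> nat) arr \<Rightarrow> (nat \<Rightarrow> nat \<Rightarrow> alg_arr) \<Rightarrow> nat \<Rightarrow> nat \<Rightarrow> alg_arr" where
  "chain_act t b = (\<lambda>i j. if i \<le> j \<and> j \<le> src t then b (fn t i) (fn t j) else undefined)"

definition day :: "hq \<Rightarrow> hq \<Rightarrow> hq" where
  "day F G = mk_hq
     (\<lambda>A U n. {Bar b c h x y | b c h x y. b \<in> chains n \<and> c \<in> chains n \<and>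
        h \<in> hom Alg (tensor (vertex b n) (vertex c n)) A \<and>
        x \<in> simplices F (vertex b 0) U n \<and> y \<in> simplices G (vertex c 0) U n})
     (\<lambda>k U n z. case z of Bar b c h x y \<Rightarrow> Bar b c (Comp Alg k h) x y)
     (\<lambda>A a n z. case z of Bar b c h x y \<Rightarrow> Bar b c h
        (site_act (obj_of F (vertex b 0)) a n x) (site_act (obj_of G (vertex c 0)) a n y))
     (\<lambda>A U t z. case z of Bar b c h x y \<Rightarrow>
        let n = tgt t; i = fn t 0; j = fn t (src t) in
        Bar (chain_act t b) (chain_act t c)
          (Comp Alg h (tensor_arr (b j n) (c j n)))
          (simp_act (obj_of (obj_of F (vertex b i)) U) t (alg_act F (b 0 i) U n x))
          (simp_act (obj_of (obj_of G (vertex c i)) U) t (alg_act G (c 0 i) U n y)))"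

definition day_map :: "hq_arr \<Rightarrow> hq_arr \<Rightarrow> hq_arr" where
  "day_map f g = mk_hq_map (day (src f) (src g)) (day (tgt f) (tgt g))
     (\<lambda>A U n z. case z of Bar b c h x y \<Rightarrow> Bar b c h
        (fn (fn (fn (fn f (vertex b 0)) U) n) x) (fn (fn (fn (fn g (vertex c 0)) U) n) y))"

end

theory Submission
  imports Defs
begin

text \<open>
  Take \<open>A\<close> to be the algebra of \<open>2 \<times> 2\<close> matrices. An element of \<open>y\<^sub>A \<otimes> y\<^sub>A\<close> at \<open>A\<close> consists of
  arrows \<open>A \<rightarrow> B\<close>, \<open>A \<rightarrow> C\<close> and \<open>B \<otimes> C \<rightarrow> A\<close>, hence yields two unital endomorphisms of \<open>A\<close> with
  commuting images. This is impossible, since the centralizer of a non-scalar matrix is commutative.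
  So \<open>y\<^sub>A \<otimes> y\<^sub>A\<close> is empty at \<open>A\<close>, whereas \<open>y\<^sub>A\<close> contains the identity there, and it remains to see that
  arrows of the homotopy category respect being inhabited, i.e. that local equivalences reflect it.
  This is detected by mapping into the initial sheaf: in the homotopy category of presheaves, a
  presheaf has exactly one arrow to it if it is not inhabited, and no arrow otherwise.
\<close>

section \<open>Categories and localizations\<close>

text \<open>For a commutative algebra the multiplication
  \<open>A \<otimes> A \<rightarrow> A\<close> is itself an arrow of \<open>Alg\<close> and gives a
  diagonal on its representable, so only a noncommutative algebra can obstruct; the 2 x 2 matrices
  are the smallest one. The obstacle is homotopical: arrows of \<open>HQ\<close> are classes of
  zigzags with formal inverses, and \<open>local_eq\<close> is known only through its effect on maps
  into sheaves. Being inhabited is therefore tested at a single manifold, the point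
  \<open>[0]\<close>; the empty manifold must be avoided, since every sheaf has a section there.
  Maps into the initial sheaf are rigid enough for its hom sets in \<open>HoPSh\<close> to be
  computed by induction on zigzags, with no fibrant replacement. Being inhabited then travels
  forward along every arrow and backward along every inverted one, first for sectionwise weak
  equivalences and, using these hom sets, for local equivalences.\<close>

lemma flip_simps [simp]:
  "src (flip a) = tgt a" "tgt (flip a) = src a" "fn (flip a) = fn a" "flip (flip a) = a"
  by (simp_all add: flip_def)

text \<open>The record \<open>cat\<close> carries data only. That endpoints of arrows are objects is
  among the laws because \<open>zigzag\<close> tests membership in \<open>Ob\<close> only at the end
  of the list.\<close>

definition category :: "('o, 'h) cat \<Rightarrow> bool" where
  "category C \<longleftrightarrow>
     (\<forall>X\<in>Ob C. Ide C X \<in> hom C X X) \<and>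
     (\<forall>a\<in>Ar C. src a \<in> Ob C \<and> tgt a \<in> Ob C \<and>
        Comp C a (Ide C (src a)) = a \<and> Comp C (Ide C (tgt a)) a = a) \<and>
     (\<forall>a\<in>Ar C. \<forall>b\<in>Ar C. tgt a = src b \<longrightarrow> Comp C b a \<in> hom C (src a) (tgt b)) \<and>
     (\<forall>a\<in>Ar C. \<forall>b\<in>Ar C. \<forall>c\<in>Ar C. tgt a = src b \<longrightarrow> tgt b = src c \<longrightarrow>
        Comp C c (Comp C b a) = Comp C (Comp C c b) a)"

lemma category_Ide: "category C \<Longrightarrow> X \<in> Ob C \<Longrightarrow> Ide C X \<in> hom C X X"
  by (simp add: category_def)

lemma category_Comp:
  "category C \<Longrightarrow> a \<in> hom C X Y \<Longrightarrow> b \<in> hom C Y Z \<Longrightarrow> Comp C b a \<in> hom C X Z"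
  by (auto simp: category_def hom_def)

lemma category_unit:
  "category C \<Longrightarrow> a \<in> hom C X Y \<Longrightarrow> Comp C a (Ide C X) = a"
  "category C \<Longrightarrow> a \<in> hom C X Y \<Longrightarrow> Comp C (Ide C Y) a = a"
  by (auto simp: category_def hom_def)

lemma category_assoc:
  "category C \<Longrightarrow> a \<in> hom C X Y \<Longrightarrow> b \<in> hom C Y Z \<Longrightarrow> c \<in> hom C Z V \<Longrightarrow>
     Comp C c (Comp C b a) = Comp C (Comp C c b) a"
  by (auto simp: category_def hom_def)

lemma category_ends: "category C \<Longrightarrow> a \<in> hom C X Y \<Longrightarrow> X \<in> Ob C \<and> Y \<in> Ob C"
  by (auto simp: category_def hom_def)

lemma categoryI:
  assumes "\<And>X. X \<in> Ob C \<Longrightarrow> Ide C X \<in> hom C X X"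
    and "\<And>a X Y. a \<in> hom C X Y \<Longrightarrow> X \<in> Ob C \<and> Y \<in> Ob C \<and> Comp C a (Ide C X) = a \<and> Comp C (Ide C Y) a = a"
    and "\<And>a b X Y Z. a \<in> hom C X Y \<Longrightarrow> b \<in> hom C Y Z \<Longrightarrow> Comp C b a \<in> hom C X Z"
    and "\<And>a b c X Y Z V. a \<in> hom C X Y \<Longrightarrow> b \<in> hom C Y Z \<Longrightarrow> c \<in> hom C Z V \<Longrightarrow>
           Comp C c (Comp C b a) = Comp C (Comp C c b) a"
  shows "category C"
  unfolding category_def using assms by (auto simp: hom_def)

lemma concrete_cat_simps [simp]:
  "Ob (concrete_cat Obs U H) = Obs"
  "Ide (concrete_cat Obs U H) X = Arr X (\<lambda>x\<in>U X. x) X"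
  "Comp (concrete_cat Obs U H) g f = Arr (src f) (compose (U (src f)) (fn g) (fn f)) (tgt g)"
  by (simp_all add: concrete_cat_def)

lemma Ar_concrete_cat:
  "a \<in> Ar (concrete_cat Obs U H) \<longleftrightarrow> src a \<in> Obs \<and> tgt a \<in> Obs \<and> fn a \<in> H (src a) (tgt a) \<and>
     fn a \<in> U (src a) \<rightarrow>\<^sub>E U (tgt a)"
  by (cases a) (auto simp: concrete_cat_def)

lemma category_concrete_cat:
  assumes "\<And>X. X \<in> Obs \<Longrightarrow> (\<lambda>x\<in>U X. x) \<in> H X X"
    and "\<And>X Y Z f g. f \<in> H X Y \<Longrightarrow> g \<in> H Y Z \<Longrightarrow> f \<in> U X \<rightarrow>\<^sub>E U Y \<Longrightarrow> g \<in> U Y \<rightarrow>\<^sub>E U Z \<Longrightarrow>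
           compose (U X) g f \<in> H X Z"
  shows "category (concrete_cat Obs U H)"
proof (rule categoryI, goal_cases)
  case (1 X)
  then show ?case using assms(1) by (auto simp: hom_def Ar_concrete_cat)
next
  case (2 a X Y)
  then have a: "src a = X" "tgt a = Y" "X \<in> Obs" "Y \<in> Obs" "fn a \<in> U X \<rightarrow>\<^sub>E U Y"
    by (auto simp: hom_def Ar_concrete_cat)
  have "compose (U X) (fn a) (\<lambda>x\<in>U X. x) = fn a" "compose (U X) (\<lambda>x\<in>U Y. x) (fn a) = fn a"
    using a(5) by (auto simp: compose_def fun_eq_iff PiE_def extensional_def Pi_def)
  with a show ?case by (cases a) auto
next
  case (3 a b X Y Z)
  then show ?case using assms(2)[of "fn a" X Y "fn b" Z]
    by (auto simp: hom_def Ar_concrete_cat compose_def PiE_def Pi_def extensional_def)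
next
  case (4 a b c X Y Z V)
  then show ?case
    by (auto simp: hom_def Ar_concrete_cat compose_def fun_eq_iff PiE_def Pi_def)
qed

lemma opp_simps [simp]:
  "Ob (opp C) = Ob C" "Ide (opp C) X = flip (Ide C X)"
  "Comp (opp C) g f = flip (Comp C (flip f) (flip g))"
  "a \<in> Ar (opp C) \<longleftrightarrow> flip a \<in> Ar C"
  by (auto simp: opp_def intro: image_eqI[of _ _ "flip a"])

lemma hom_self: "a \<in> Ar C \<Longrightarrow> a \<in> hom C (src a) (tgt a)"
  by (simp add: hom_def)

lemma Fun_simps [simp]:
  "F \<in> Ob (Fun C D) \<longleftrightarrow> is_functor C D F"
  "Ide (Fun C D) F = Arr F (\<lambda>X\<in>Ob C. Ide D (obj_of F X)) F"
  "Comp (Fun C D) s t = Arr (src t) (\<lambda>X\<in>Ob C. Comp D (fn s X) (fn t X)) (tgt s)"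
  by (simp_all add: Fun_def)

lemma Ar_Fun:
  "a \<in> Ar (Fun C D) \<longleftrightarrow> is_functor C D (src a) \<and> is_functor C D (tgt a) \<and>
     fn a \<in> (\<Pi>\<^sub>E X\<in>Ob C. hom D (obj_of (src a) X) (obj_of (tgt a) X)) \<and>
     (\<forall>k\<in>Ar C. Comp D (fn a (tgt k)) (arr_of (src a) k) = Comp D (arr_of (tgt a) k) (fn a (src k)))"
  by (cases a) (auto simp: Fun_def)

lemma hom_Fun_iff:
  "a \<in> hom (Fun C D) F G \<longleftrightarrow> src a = F \<and> tgt a = G \<and> is_functor C D F \<and> is_functor C D G \<and>
     fn a \<in> (\<Pi>\<^sub>E X\<in>Ob C. hom D (obj_of F X) (obj_of G X)) \<and>
     (\<forall>k\<in>Ar C. Comp D (fn a (tgt k)) (arr_of F k) = Comp D (arr_of G k) (fn a (src k)))"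
  by (auto simp: hom_def[of "Fun C D"] Ar_Fun)

lemma hom_Fun_component:
  "a \<in> hom (Fun C D) F G \<Longrightarrow> X \<in> Ob C \<Longrightarrow> fn a X \<in> hom D (obj_of F X) (obj_of G X)"
  by (auto simp: hom_Fun_iff)

lemma functor_arr:
  "is_functor C D F \<Longrightarrow> a \<in> Ar C \<Longrightarrow> arr_of F a \<in> hom D (obj_of F (src a)) (obj_of F (tgt a))"
  by (simp add: is_functor_def)

lemma functor_obj: "is_functor C D F \<Longrightarrow> X \<in> Ob C \<Longrightarrow> obj_of F X \<in> Ob D"
  by (simp add: is_functor_def)

text \<open>The condition on \<open>C\<close> is confined to endpoints of arrows, so that it applies
  to \<open>opp Site\<close> before anything is known about composites of smooth maps.\<close>

lemma category_Fun:
  assumes C: "\<And>a. a \<in> Ar C \<Longrightarrow> src a \<in> Ob C \<and> tgt a \<in> Ob C" and D: "category D"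
  shows "category (Fun C D)"
proof (rule categoryI, goal_cases)
  case (1 F)
  then show ?case
    using D C by (auto simp: hom_Fun_iff category_Ide functor_obj
        category_unit[OF D functor_arr[of C D F]])
next
  case (2 a F G)
  have *: "f \<in> (\<Pi>\<^sub>E X\<in>Ob C. hom D (obj_of F X) (obj_of G X)) \<Longrightarrow>
      restrict (\<lambda>X. Comp D (f X) (restrict (\<lambda>X. Ide D (obj_of F X)) (Ob C) X)) (Ob C) = f"
     "f \<in> (\<Pi>\<^sub>E X\<in>Ob C. hom D (obj_of F X) (obj_of G X)) \<Longrightarrow>
      restrict (\<lambda>X. Comp D (restrict (\<lambda>X. Ide D (obj_of G X)) (Ob C) X) (f X)) (Ob C) = f" for f
    using category_unit[OF D]
    by (auto simp: fun_eq_iff PiE_def Pi_def extensional_def)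
  show ?case using 2 * by (cases a) (auto simp: hom_Fun_iff)
next
  case (3 a b F G H)
  have "Comp D (Comp D (fn b (tgt k)) (fn a (tgt k))) (arr_of F k) =
        Comp D (arr_of H k) (Comp D (fn b (src k)) (fn a (src k)))" if k: "k \<in> Ar C" for k
  proof -
    note F = functor_arr[of C D F, OF _ k] and G = functor_arr[of C D G, OF _ k]
      and H = functor_arr[of C D H, OF _ k]
    have fs: "is_functor C D F" "is_functor C D G" "is_functor C D H"
      using 3 by (auto simp: hom_Fun_iff)
    have c: "src k \<in> Ob C" "tgt k \<in> Ob C" using C k by auto
    note a = hom_Fun_component[OF 3(1)] and b = hom_Fun_component[OF 3(2)]
    have "Comp D (Comp D (fn b (tgt k)) (fn a (tgt k))) (arr_of F k) =
        Comp D (fn b (tgt k)) (Comp D (fn a (tgt k)) (arr_of F k))"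
      using category_assoc[OF D F[OF fs(1)] a[OF c(2)] b[OF c(2)]] by simp
    also have "\<dots> = Comp D (fn b (tgt k)) (Comp D (arr_of G k) (fn a (src k)))"
      using 3(1) k by (auto simp: hom_Fun_iff)
    also have "\<dots> = Comp D (Comp D (fn b (tgt k)) (arr_of G k)) (fn a (src k))"
      using category_assoc[OF D a[OF c(1)] G[OF fs(2)] b[OF c(2)]] by simp
    also have "\<dots> = Comp D (Comp D (arr_of H k) (fn b (src k))) (fn a (src k))"
      using 3(2) k by (auto simp: hom_Fun_iff)
    also have "\<dots> = Comp D (arr_of H k) (Comp D (fn b (src k)) (fn a (src k)))"
      using category_assoc[OF D a[OF c(1)] b[OF c(1)] H[OF fs(3)]] by simp
    finally show ?thesis .
  qed
  then show ?case using 3 C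
    by (auto simp: hom_Fun_iff intro!: category_Comp[OF D])
next
  case (4 a b c F G H I)
  have "Comp D (fn c X) (Comp D (fn b X) (fn a X)) = Comp D (Comp D (fn c X) (fn b X)) (fn a X)"
    if "X \<in> Ob C" for X
    by (rule category_assoc[OF D hom_Fun_component[OF 4(1) that] hom_Fun_component[OF 4(2) that]
          hom_Fun_component[OF 4(3) that]])
  with 4 show ?case by (auto simp: hom_Fun_iff fun_eq_iff)
qed

lemma Ar_opp: "Ar (opp C) = flip ` Ar C"
  by (simp add: opp_def)

text \<open>Writes each arrow of \<open>opp C\<close> as \<open>flip a\<close>, so that all later
  conditions quantify over arrows of \<open>C\<close> itself.\<close>

lemma is_functor_opp:
  "is_functor (opp C) D F \<longleftrightarrow>
     (\<forall>X\<in>Ob C. obj_of F X \<in> Ob D \<and> arr_of F (flip (Ide C X)) = Ide D (obj_of F X)) \<and>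
     (\<forall>a\<in>Ar C. arr_of F (flip a) \<in> hom D (obj_of F (tgt a)) (obj_of F (src a))) \<and>
     (\<forall>a\<in>Ar C. \<forall>b\<in>Ar C. tgt b = src a \<longrightarrow>
        arr_of F (flip (Comp C a b)) = Comp D (arr_of F (flip b)) (arr_of F (flip a)))"
  unfolding is_functor_def Ar_opp by (auto simp del: opp_simps(4))

lemma hom_Fun_opp:
  "a \<in> hom (Fun (opp C) D) F G \<longleftrightarrow> src a = F \<and> tgt a = G \<and>
     is_functor (opp C) D F \<and> is_functor (opp C) D G \<and>
     fn a \<in> (\<Pi>\<^sub>E X\<in>Ob C. hom D (obj_of F X) (obj_of G X)) \<and>
     (\<forall>k\<in>Ar C. Comp D (fn a (src k)) (arr_of F (flip k)) = Comp D (arr_of G (flip k)) (fn a (tgt k)))"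
  unfolding hom_Fun_iff Ar_opp by simp

section \<open>Zigzags and composition in a localization\<close>

definition zz_step ::
    "('o, 'h) cat \<Rightarrow> ('o, 'h) arr set \<Rightarrow> 'o \<Rightarrow> 'o \<Rightarrow> ('o, 'h) step list \<Rightarrow> ('o, 'h) step list \<Rightarrow> bool" where
  "zz_step C W X Y = (\<lambda>p q. \<exists>r l l' s. p = r @ l @ s \<and> q = r @ l' @ s \<and>
     (l, l') \<in> zz_relations C W \<and> zigzag C W X p Y \<and> zigzag C W X q Y)"

abbreviation zz_equiv where "zz_equiv C W X Y \<equiv> equivclp (zz_step C W X Y)"

lemma zigzag_append:
  assumes C: "category C"
  shows "zigzag C W X (p @ q) Z \<longleftrightarrow> (\<exists>Y. zigzag C W X p Y \<and> zigzag C W Y q Z)"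
proof (induction p arbitrary: X)
  case Nil
  \<comment> \<open>With an empty prefix, that the start is an object has to be recovered from the
    first step of \<open>q\<close>.\<close>
  have "zigzag C W X q Z \<Longrightarrow> X \<in> Ob C"
  proof (cases q)
    case (Cons s q')
    then show "zigzag C W X q Z \<Longrightarrow> X \<in> Ob C" using C by (cases s) (auto simp: category_def)
  qed auto
  then show ?case by auto
next
  case (Cons s p)
  then show ?case by (cases s) auto
qed

lemma zz_class_eq: "zz_class C W X Y p = {q. zz_equiv C W X Y p q}"
  by (simp add: zz_class_def zz_step_def)

lemma zz_class_eqI: "zz_equiv C W X Y p q \<Longrightarrow> zz_class C W X Y p = zz_class C W X Y q"
  unfolding zz_class_eq
  by (rule Collect_cong) (meson equivclp_trans equivclp_sym)

context
  fixes C :: "('o, 'h) cat" and W :: "('o, 'h) arr set"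
  assumes C: "category C"
begin

lemma zigzag_append3:
  "zigzag C W X u Y \<Longrightarrow> zigzag C W Y p Z \<Longrightarrow> zigzag C W Z v V \<Longrightarrow> zigzag C W X (u @ p @ v) V"
  unfolding zigzag_append[OF C] by (intro exI conjI)

lemma zz_step_context:
  assumes s: "zz_step C W Y Z p q" and u: "zigzag C W X u Y" and v: "zigzag C W Z v V"
  shows "zz_step C W X V (u @ p @ v) (u @ q @ v)"
  using s unfolding zz_step_def
proof (elim exE conjE)
  fix r l l' s
  assume e: "p = r @ l @ s" "q = r @ l' @ s" "(l, l') \<in> zz_relations C W"
      "zigzag C W Y p Z" "zigzag C W Y q Z"
  have z: "zigzag C W X (u @ p @ v) V" "zigzag C W X (u @ q @ v) V"
    by (rule zigzag_append3[OF u e(4) v], rule zigzag_append3[OF u e(5) v])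
  have l: "u @ p @ v = (u @ r) @ l @ (s @ v)" "u @ q @ v = (u @ r) @ l' @ (s @ v)"
    unfolding e(1,2) by simp_all
  show "\<exists>r l l' s. u @ p @ v = r @ l @ s \<and> u @ q @ v = r @ l' @ s \<and>
     (l, l') \<in> zz_relations C W \<and> zigzag C W X (u @ p @ v) V \<and> zigzag C W X (u @ q @ v) V"
    by (rule exI[of _ "u @ r"], rule exI[of _ l], rule exI[of _ l'], rule exI[of _ "s @ v"],
        intro conjI l e(3) z)
qed

text \<open>Congruence: a rewriting step stays a rewriting step inside a longer zigzag. This makes
  composition well defined and allows a zigzag to be simplified piecewise.\<close>

lemma zz_equiv_context:
  assumes e: "zz_equiv C W Y Z p q" and u: "zigzag C W X u Y" and v: "zigzag C W Z v V"
  shows "zz_equiv C W X V (u @ p @ v) (u @ q @ v)"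
  using e
proof (induction rule: equivclp_induct)
  case (step y z)
  have "zz_equiv C W X V (u @ y @ v) (u @ z @ v)"
    using step(2)
  proof
    assume "zz_step C W Y Z y z"
    from zz_step_context[OF this u v] show ?thesis by (rule r_into_equivclp)
  next
    assume "zz_step C W Y Z z y"
    from zz_step_context[OF this u v] show ?thesis by (rule equivclp_sym[OF r_into_equivclp])
  qed
  with step(3) show ?case by (rule equivclp_trans)
qed simp

lemma zz_equiv_zigzag:
  assumes "zz_equiv C W X Y p q" "zigzag C W X p Y"
  shows "zigzag C W X q Y"
  using assms
proof (induction rule: equivclp_induct)
  case (step y z)
  from step(2) show ?case by (auto simp: zz_step_def)
qed

text \<open>\<open>Comp\<close> takes a union over all pairs of representatives. By congruence in
  each argument all the classes in it coincide, so the union is a single class.\<close>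

lemma localization_Comp:
  assumes p: "zigzag C W X p Y" and q: "zigzag C W Y q Z"
  shows "Comp (localization C W) (Arr Y (zz_class C W Y Z q) Z) (Arr X (zz_class C W X Y p) Y) =
           Arr X (zz_class C W X Z (p @ q)) Z"
proof -
  have "zz_class C W X Z (p' @ q') = zz_class C W X Z (p @ q)"
    if p': "p' \<in> zz_class C W X Y p" and q': "q' \<in> zz_class C W Y Z q" for p' q'
  proof -
    have p1: "zz_equiv C W X Y p p'" and q1: "zz_equiv C W Y Z q q'"
      using p' q' by (simp_all add: zz_class_eq)
    have "zz_equiv C W X Z (p @ q) (p @ q')"
      using zz_equiv_context[OF q1 p, of "[]" Z] zigzag_append[OF C, of W Y q "[]" Z] q by simp
    moreover have "zz_equiv C W X Z (p @ q') (p' @ q')"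
      using zz_equiv_context[OF p1 _ zz_equiv_zigzag[OF q1 q], of X "[]"]
        zigzag_append[OF C, of W X "[]" p Y] p by simp
    ultimately show ?thesis by (metis zz_class_eqI)
  qed
  moreover have "p \<in> zz_class C W X Y p" "q \<in> zz_class C W Y Z q"
    by (simp_all add: zz_class_eq)
  ultimately have "(\<Union>p\<in>zz_class C W X Y p. \<Union>q\<in>zz_class C W Y Z q. zz_class C W X Z (p @ q)) =
      zz_class C W X Z (p @ q)"
    by blast
  then show ?thesis by (simp add: localization_def)
qed

lemma hom_localization:
  "a \<in> hom (localization C W) X Y \<longleftrightarrow> (\<exists>p. zigzag C W X p Y \<and> a = Arr X (zz_class C W X Y p) Y)"
  by (auto simp: hom_def localization_def)

lemma localization_Comp_hom:
  assumes "a \<in> hom (localization C W) X Y" "b \<in> hom (localization C W) Y Z"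
  shows "Comp (localization C W) b a \<in> hom (localization C W) X Z"
proof -
  obtain p q where "zigzag C W X p Y" "a = Arr X (zz_class C W X Y p) Y"
      "zigzag C W Y q Z" "b = Arr Y (zz_class C W Y Z q) Z"
    using assms by (auto simp: hom_localization)
  then show ?thesis
    using localization_Comp[of X p Y q Z] zigzag_append[OF C, of W X p q Z]
    by (auto simp: hom_localization)
qed

lemma loc_arr_hom:
  assumes "a \<in> hom C X Y"
  shows "loc_arr C W a \<in> hom (localization C W) X Y"
proof -
  have "zigzag C W X [Fwd a] Y" using assms category_ends[OF C assms] by (auto simp: hom_def)
  moreover have "loc_arr C W a = Arr X (zz_class C W X Y [Fwd a]) Y"
    using assms by (simp add: loc_arr_def hom_def)
  ultimately show ?thesis unfolding hom_localization by blast
qed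

end

lemma zz_equiv_relation:
  "(l, l') \<in> zz_relations C W \<Longrightarrow> zigzag C W X l Y \<Longrightarrow> zigzag C W X l' Y \<Longrightarrow> zz_equiv C W X Y l l'"
  unfolding zz_step_def
  by (rule r_into_equivclp, rule exI[of _ "[]"], rule exI[of _ l], rule exI[of _ l'], rule exI[of _ "[]"]) simp

section \<open>Simplicial sets and simplicial presheaves\<close>

lemma Ob_sites [simp]: "Ob Simplex = UNIV" "Ob Site = UNIV" "Ob SetCat = UNIV"
  by (simp_all add: Simplex_def Site_def SetCat_def)

lemma Simplex_simps [simp]:
  "src (Ide Simplex n) = n" "tgt (Ide Simplex n) = n"
  "src (Comp Simplex t s) = src s" "tgt (Comp Simplex t s) = tgt t"
  by (simp_all add: Simplex_def)

lemma Site_simps [simp]: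
  "src (Ide Site U) = U" "tgt (Ide Site U) = U"
  "src (Comp Site a b) = src b" "tgt (Comp Site a b) = tgt a"
  by (simp_all add: Site_def)

lemma SetCat_simps [simp]:
  "Ide SetCat S = Arr S (\<lambda>x\<in>S. x) S"
  "Comp SetCat g f = Arr (src f) (compose (src f) (fn g) (fn f)) (tgt g)"
  by (simp_all add: SetCat_def)

lemma hom_SetCat: "a \<in> hom SetCat S T \<longleftrightarrow> src a = S \<and> tgt a = T \<and> fn a \<in> S \<rightarrow>\<^sub>E T"
  by (auto simp: hom_def SetCat_def Ar_concrete_cat)

lemma category_SetCat: "category SetCat"
  unfolding SetCat_def by (rule category_concrete_cat) auto

lemma category_sSet: "category sSet"
  unfolding sSet_def by (rule category_Fun[OF _ category_SetCat]) simp

lemma category_sPSh: "category sPSh"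
  unfolding sPSh_def by (rule category_Fun[OF _ category_sSet]) simp

lemma sSet_Ob: "X \<in> Ob sSet \<longleftrightarrow> is_functor (opp Simplex) SetCat X"
  by (simp add: sSet_def)

lemma sPSh_Ob: "P \<in> Ob sPSh \<longleftrightarrow> is_functor (opp Site) sSet P"
  by (simp add: sPSh_def)

lemma sset_arr:
  "X \<in> Ob sSet \<Longrightarrow> t \<in> Ar Simplex \<Longrightarrow> arr_of X (flip t) \<in> hom SetCat (obj_of X (tgt t)) (obj_of X (src t))"
  by (simp add: sSet_Ob is_functor_opp)

lemma arr_of_sset:
  assumes "X \<in> Ob sSet" "t \<in> Ar Simplex"
  shows "arr_of X (flip t) = Arr (obj_of X (tgt t)) (simp_act X t) (obj_of X (src t))"
  using sset_arr[OF assms] by (cases "arr_of X (flip t)") (auto simp: simp_act_def hom_SetCat)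

lemma simp_act_in:
  "X \<in> Ob sSet \<Longrightarrow> t \<in> Ar Simplex \<Longrightarrow> x \<in> obj_of X (tgt t) \<Longrightarrow> simp_act X t x \<in> obj_of X (src t)"
  using sset_arr[of X t] by (auto simp: simp_act_def hom_SetCat)

lemma simp_act_Ide: "X \<in> Ob sSet \<Longrightarrow> x \<in> obj_of X n \<Longrightarrow> simp_act X (Ide Simplex n) x = x"
  by (simp add: sSet_Ob is_functor_opp simp_act_def)

lemma simp_act_Comp:
  assumes "X \<in> Ob sSet" "t \<in> Ar Simplex" "s \<in> Ar Simplex" "tgt s = src t" "x \<in> obj_of X (tgt t)"
  shows "simp_act X (Comp Simplex t s) x = simp_act X s (simp_act X t x)"
proof -
  have "arr_of X (flip (Comp Simplex t s)) = Comp SetCat (arr_of X (flip s)) (arr_of X (flip t))"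
    using assms by (simp add: sSet_Ob is_functor_opp)
  then show ?thesis
    using assms(5) sset_arr[OF assms(1,2)] by (simp add: simp_act_def hom_SetCat compose_def)
qed

lemma obj_of_mk_sset [simp]: "obj_of (mk_sset S d) = S"
  by (simp add: mk_sset_def)

lemma simp_act_mk_sset [simp]: "x \<in> S (tgt t) \<Longrightarrow> simp_act (mk_sset S d) t x = d t x"
  by (simp add: mk_sset_def simp_act_def)

lemma mk_sset_Ob:
  assumes "\<And>t x. t \<in> Ar Simplex \<Longrightarrow> x \<in> S (tgt t) \<Longrightarrow> d t x \<in> S (src t)"
    and "\<And>n x. x \<in> S n \<Longrightarrow> d (Ide Simplex n) x = x"
    and "\<And>t s x. t \<in> Ar Simplex \<Longrightarrow> s \<in> Ar Simplex \<Longrightarrow> tgt s = src t \<Longrightarrow> x \<in> S (tgt t) \<Longrightarrow>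
           d (Comp Simplex t s) x = d s (d t x)"
  shows "mk_sset S d \<in> Ob sSet"
proof -
  have arr: "arr_of (mk_sset S d) (flip t) = Arr (S (tgt t)) (restrict (d t) (S (tgt t))) (S (src t))" for t
    by (simp add: mk_sset_def)
  show ?thesis
    unfolding sSet_Ob is_functor_opp arr
    using assms by (simp add: hom_SetCat fun_eq_iff compose_def)
qed

lemma sset_map_component: "f \<in> hom sSet X Y \<Longrightarrow> fn f n \<in> hom SetCat (obj_of X n) (obj_of Y n)"
  by (simp add: sSet_def hom_Fun_opp PiE_def Pi_def)

lemma sset_map_in: "f \<in> hom sSet X Y \<Longrightarrow> x \<in> obj_of X n \<Longrightarrow> fn (fn f n) x \<in> obj_of Y n"
  using sset_map_component[of f X Y n] by (auto simp: hom_SetCat)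

lemma sset_map_natural:
  assumes f: "f \<in> hom sSet X Y" and t: "t \<in> Ar Simplex" and x: "x \<in> obj_of X (tgt t)"
  shows "fn (fn f (src t)) (simp_act X t x) = simp_act Y t (fn (fn f (tgt t)) x)"
proof -
  have XY: "X \<in> Ob sSet" "Y \<in> Ob sSet" using category_ends[OF category_sSet f] by auto
  have "Comp SetCat (fn f (src t)) (arr_of X (flip t)) = Comp SetCat (arr_of Y (flip t)) (fn f (tgt t))"
    using f t by (simp add: sSet_def hom_Fun_opp del: SetCat_simps)
  then show ?thesis
    using XY t x sset_map_component[OF f, of "tgt t"]
    by (auto simp: arr_of_sset compose_def fun_eq_iff hom_SetCat dest: spec[of _ x])
qed

text \<open>Components are extensional functions with fixed source and target, so agreement on
  simplices forces equality of the arrows. The uniqueness of maps into the initial sheaf rests on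
  this.\<close>

lemma sset_map_eqI:
  assumes f: "f \<in> hom sSet X Y" and g: "g \<in> hom sSet X Y"
    and "\<And>n x. x \<in> obj_of X n \<Longrightarrow> fn (fn f n) x = fn (fn g n) x"
  shows "f = g"
proof -
  have "fn f n = fn g n" for n
  proof -
    note c = sset_map_component[OF f, of n] sset_map_component[OF g, of n]
    have "fn (fn f n) = fn (fn g n)"
      using c assms(3) by (intro PiE_ext[of _ "obj_of X n" "\<lambda>_. obj_of Y n"]) (auto simp: hom_SetCat)
    then show ?thesis using c by (cases "fn f n"; cases "fn g n") (auto simp: hom_SetCat)
  qed
  then have "fn f = fn g" by auto
  then show ?thesis using f g by (cases f; cases g) (auto simp: hom_def)
qed

lemma mk_sset_map_hom:
  assumes X: "X \<in> Ob sSet" and Y: "Y \<in> Ob sSet"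
    and f: "\<And>n x. x \<in> obj_of X n \<Longrightarrow> f n x \<in> obj_of Y n"
    and nat: "\<And>t x. t \<in> Ar Simplex \<Longrightarrow> x \<in> obj_of X (tgt t) \<Longrightarrow>
                f (src t) (simp_act X t x) = simp_act Y t (f (tgt t) x)"
  shows "mk_sset_map X Y f \<in> hom sSet X Y"
proof -
  have "Comp SetCat (fn (mk_sset_map X Y f) (src t)) (arr_of X (flip t)) =
      Comp SetCat (arr_of Y (flip t)) (fn (mk_sset_map X Y f) (tgt t))" if t: "t \<in> Ar Simplex" for t
    unfolding arr_of_sset[OF X t] arr_of_sset[OF Y t]
    using nat[OF t] simp_act_in[OF X t] by (simp add: mk_sset_map_def fun_eq_iff compose_def)
  moreover have "fn (mk_sset_map X Y f) n \<in> hom SetCat (obj_of X n) (obj_of Y n)" for n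
    using f by (simp add: mk_sset_map_def hom_SetCat)
  ultimately show ?thesis using X Y
    unfolding sSet_def hom_Fun_opp by (simp add: sSet_Ob mk_sset_map_def PiE_def Pi_def del: SetCat_simps)
qed

lemma fn_mk_sset_map [simp]: "x \<in> obj_of X n \<Longrightarrow> fn (fn (mk_sset_map X Y f) n) x = f n x"
  by (simp add: mk_sset_map_def)

lemma spsh_obj: "P \<in> Ob sPSh \<Longrightarrow> obj_of P U \<in> Ob sSet"
  by (simp add: sPSh_Ob is_functor_opp)

lemma spsh_arr:
  "P \<in> Ob sPSh \<Longrightarrow> a \<in> Ar Site \<Longrightarrow> arr_of P (flip a) \<in> hom sSet (obj_of P (tgt a)) (obj_of P (src a))"
  by (simp add: sPSh_Ob is_functor_opp)

lemma site_act_in: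
  "P \<in> Ob sPSh \<Longrightarrow> a \<in> Ar Site \<Longrightarrow> x \<in> obj_of (obj_of P (tgt a)) n \<Longrightarrow>
     site_act P a n x \<in> obj_of (obj_of P (src a)) n"
  unfolding site_act_def by (rule sset_map_in[OF spsh_arr])

lemma site_act_natural:
  "P \<in> Ob sPSh \<Longrightarrow> a \<in> Ar Site \<Longrightarrow> t \<in> Ar Simplex \<Longrightarrow> x \<in> obj_of (obj_of P (tgt a)) (tgt t) \<Longrightarrow>
     site_act P a (src t) (simp_act (obj_of P (tgt a)) t x) =
     simp_act (obj_of P (src a)) t (site_act P a (tgt t) x)"
  unfolding site_act_def by (rule sset_map_natural[OF spsh_arr])

lemma site_act_Ide:
  assumes "P \<in> Ob sPSh" "x \<in> obj_of (obj_of P U) n"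
  shows "site_act P (Ide Site U) n x = x"
proof -
  have "arr_of P (flip (Ide Site U)) = Ide sSet (obj_of P U)"
    using assms(1) by (simp add: sPSh_Ob is_functor_opp)
  then show ?thesis using assms(2) by (simp add: site_act_def sSet_def)
qed

lemma fn_Comp_sSet:
  assumes "f \<in> hom sSet X Y" "x \<in> obj_of X n"
  shows "fn (fn (Comp sSet g f) n) x = fn (fn g n) (fn (fn f n) x)"
  using sset_map_component[OF assms(1), of n] assms(2) by (simp add: sSet_def hom_SetCat compose_def)

lemma site_act_Comp:
  assumes P: "P \<in> Ob sPSh" and "a \<in> Ar Site" "b \<in> Ar Site" "tgt b = src a"
    and x: "x \<in> obj_of (obj_of P (tgt a)) n"
  shows "site_act P (Comp Site a b) n x = site_act P b n (site_act P a n x)"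
proof -
  have "arr_of P (flip (Comp Site a b)) = Comp sSet (arr_of P (flip b)) (arr_of P (flip a))"
    using assms by (simp add: sPSh_Ob is_functor_opp)
  then show ?thesis
    unfolding site_act_def using fn_Comp_sSet[OF spsh_arr[OF P assms(2)] x] by simp
qed

lemma spsh_map_component: "f \<in> hom sPSh P Q \<Longrightarrow> fn f U \<in> hom sSet (obj_of P U) (obj_of Q U)"
  by (simp add: sPSh_def hom_Fun_opp PiE_def Pi_def)

lemma spsh_map_in:
  "f \<in> hom sPSh P Q \<Longrightarrow> x \<in> obj_of (obj_of P U) n \<Longrightarrow> fn (fn (fn f U) n) x \<in> obj_of (obj_of Q U) n"
  by (rule sset_map_in[OF spsh_map_component])

lemma spsh_map_natural:
  assumes f: "f \<in> hom sPSh P Q" and a: "a \<in> Ar Site" and x: "x \<in> obj_of (obj_of P (tgt a)) n"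
  shows "fn (fn (fn f (src a)) n) (site_act P a n x) = site_act Q a n (fn (fn (fn f (tgt a)) n) x)"
proof -
  have PQ: "P \<in> Ob sPSh" "Q \<in> Ob sPSh" using category_ends[OF category_sPSh f] by auto
  have "Comp sSet (fn f (src a)) (arr_of P (flip a)) = Comp sSet (arr_of Q (flip a)) (fn f (tgt a))"
    using f a by (simp add: sPSh_def hom_Fun_opp)
  then show ?thesis unfolding site_act_def
    using fn_Comp_sSet[OF spsh_arr[OF PQ(1) a] x] fn_Comp_sSet[OF spsh_map_component[OF f] x]
    by metis
qed

lemma spsh_map_eqI:
  assumes f: "f \<in> hom sPSh P Q" and g: "g \<in> hom sPSh P Q"
    and "\<And>U n x. x \<in> obj_of (obj_of P U) n \<Longrightarrow> fn (fn (fn f U) n) x = fn (fn (fn g U) n) x"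
  shows "f = g"
proof -
  have "fn f U = fn g U" for U
    by (rule sset_map_eqI[OF spsh_map_component[OF f] spsh_map_component[OF g] assms(3)])
  then have "fn f = fn g" by auto
  then show ?thesis using f g by (cases f; cases g) (auto simp: hom_def)
qed

lemma mk_spsh_map_hom:
  assumes P: "P \<in> Ob sPSh" and Q: "Q \<in> Ob sPSh"
    and f: "\<And>U n x. x \<in> obj_of (obj_of P U) n \<Longrightarrow> f U n x \<in> obj_of (obj_of Q U) n"
    and simp: "\<And>U t x. t \<in> Ar Simplex \<Longrightarrow> x \<in> obj_of (obj_of P U) (tgt t) \<Longrightarrow>
           f U (src t) (simp_act (obj_of P U) t x) = simp_act (obj_of Q U) t (f U (tgt t) x)"
    and site: "\<And>a n x. a \<in> Ar Site \<Longrightarrow> x \<in> obj_of (obj_of P (tgt a)) n \<Longrightarrow>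
           f (src a) n (site_act P a n x) = site_act Q a n (f (tgt a) n x)"
  shows "mk_spsh_map P Q f \<in> hom sPSh P Q"
proof -
  define F where "F U = mk_sset_map (obj_of P U) (obj_of Q U) (f U)" for U
  have F: "F U \<in> hom sSet (obj_of P U) (obj_of Q U)" for U
    unfolding F_def by (rule mk_sset_map_hom) (auto simp: spsh_obj P Q f simp)
  have "Comp sSet (F (src k)) (arr_of P (flip k)) = Comp sSet (arr_of Q (flip k)) (F (tgt k))"
    if k: "k \<in> Ar Site" for k
    by (rule sset_map_eqI[OF category_Comp[OF category_sSet spsh_arr[OF P k] F]
            category_Comp[OF category_sSet F spsh_arr[OF Q k]]])
       (use site[OF k] site_act_in[OF P k] in
        \<open>simp add: fn_Comp_sSet[OF spsh_arr[OF P k]] fn_Comp_sSet[OF F[unfolded F_def]] F_def site_act_def\<close>)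
  then show ?thesis using P Q F
    unfolding sPSh_def hom_Fun_opp by (simp add: mk_spsh_map_def sPSh_Ob F_def PiE_def Pi_def)
qed

lemma fn_mk_spsh_map [simp]:
  "x \<in> obj_of (obj_of P U) n \<Longrightarrow> fn (fn (fn (mk_spsh_map P Q f) U) n) x = f U n x"
  by (simp add: mk_spsh_map_def)

lemma mk_spsh_map_ends [simp]: "src (mk_spsh_map P Q f) = P" "tgt (mk_spsh_map P Q f) = Q"
  by (simp_all add: mk_spsh_map_def)

lemma obj_of_mk_spsh: "obj_of (mk_spsh S m d) U = mk_sset (S U) (d U)"
  by (simp add: mk_spsh_def Let_def)

lemma obj_of_obj_of_mk_spsh [simp]: "obj_of (obj_of (mk_spsh S m d) U) n = S U n"
  by (simp add: obj_of_mk_spsh)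

lemma simp_act_mk_spsh [simp]:
  "x \<in> S U (tgt t) \<Longrightarrow> simp_act (obj_of (mk_spsh S m d) U) t x = d U t x"
  by (simp add: obj_of_mk_spsh)

lemma site_act_mk_spsh [simp]: "x \<in> S (tgt a) n \<Longrightarrow> site_act (mk_spsh S m d) a n x = m a n x"
  by (simp add: mk_spsh_def Let_def site_act_def)

lemma mk_spsh_Ob:
  assumes d: "\<And>U t x. t \<in> Ar Simplex \<Longrightarrow> x \<in> S U (tgt t) \<Longrightarrow> d U t x \<in> S U (src t)"
    and d1: "\<And>U n x. x \<in> S U n \<Longrightarrow> d U (Ide Simplex n) x = x"
    and d2: "\<And>U t s x. t \<in> Ar Simplex \<Longrightarrow> s \<in> Ar Simplex \<Longrightarrow> tgt s = src t \<Longrightarrow> x \<in> S U (tgt t) \<Longrightarrow>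
           d U (Comp Simplex t s) x = d U s (d U t x)"
    and m: "\<And>a n x. a \<in> Ar Site \<Longrightarrow> x \<in> S (tgt a) n \<Longrightarrow> m a n x \<in> S (src a) n"
    and m1: "\<And>U n x. x \<in> S U n \<Longrightarrow> m (Ide Site U) n x = x"
    and m2: "\<And>a b n x. a \<in> Ar Site \<Longrightarrow> b \<in> Ar Site \<Longrightarrow> tgt b = src a \<Longrightarrow> x \<in> S (tgt a) n \<Longrightarrow>
           m (Comp Site a b) n x = m b n (m a n x)"
    and md: "\<And>a t x. a \<in> Ar Site \<Longrightarrow> t \<in> Ar Simplex \<Longrightarrow> x \<in> S (tgt a) (tgt t) \<Longrightarrow>
           m a (src t) (d (tgt a) t x) = d (src a) t (m a (tgt t) x)"
  shows "mk_spsh S m d \<in> Ob sPSh"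
proof -
  define P where "P U = mk_sset (S U) (d U)" for U
  define M where "M a = mk_sset_map (P (tgt a)) (P (src a)) (m a)" for a
  have P: "P U \<in> Ob sSet" for U
    unfolding P_def by (rule mk_sset_Ob) (auto simp: d d1 d2)
  have Pn [simp]: "obj_of (P U) n = S U n" for U n by (simp add: P_def)
  have M: "M a \<in> hom sSet (P (tgt a)) (P (src a))" if "a \<in> Ar Site" for a
    unfolding M_def by (rule mk_sset_map_hom) (use that in \<open>auto simp: P m, auto simp: P_def m md\<close>)
  have M1: "M (Ide Site U) = Ide sSet (P U)" for U
    unfolding M_def mk_sset_map_def sSet_def using m1 by (auto simp: fun_eq_iff)
  have M2: "M (Comp Site a b) = Comp sSet (M b) (M a)"
    if "a \<in> Ar Site" "b \<in> Ar Site" "tgt b = src a" for a b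
    unfolding M_def mk_sset_map_def sSet_def using m2[OF that] m[OF that(1)] that
    by (auto simp: fun_eq_iff compose_def)
  have "obj_of (mk_spsh S m d) = P" "arr_of (mk_spsh S m d) (flip a) = M a" for a
    by (simp_all add: mk_spsh_def P_def M_def Let_def fun_eq_iff)
  then show ?thesis unfolding sPSh_Ob is_functor_opp using P M M1 M2 by simp
qed

lemma psh_times_Ob:
  assumes P: "P \<in> Ob sPSh" and K: "K \<in> Ob sSet"
  shows "psh_times P K \<in> Ob sPSh"
  unfolding psh_times_def
  by (rule mk_spsh_Ob)
     (use assms in \<open>auto simp: simp_act_in simp_act_Ide simp_act_Comp spsh_obj
        site_act_in site_act_Ide site_act_Comp site_act_natural\<close>)

lemma obj_of_psh_times [simp]:
  "obj_of (obj_of (psh_times P K) U) n =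
     {Pr x k | x k. x \<in> obj_of (obj_of P U) n \<and> k \<in> obj_of K n}"
  by (simp add: psh_times_def)

lemma psh_times_acts:
  "x \<in> obj_of (obj_of P U) (tgt t) \<Longrightarrow> k \<in> obj_of K (tgt t) \<Longrightarrow>
     simp_act (obj_of (psh_times P K) U) t (Pr x k) = Pr (simp_act (obj_of P U) t x) (simp_act K t k)"
  "x \<in> obj_of (obj_of P (tgt a)) n \<Longrightarrow> k \<in> obj_of K n \<Longrightarrow>
     site_act (psh_times P K) a n (Pr x k) = Pr (site_act P a n x) k"
  by (auto simp: psh_times_def)

lemma psh_times_map_hom:
  assumes f: "f \<in> hom sPSh P Q" and K: "K \<in> Ob sSet"
  shows "psh_times_map f K \<in> hom sPSh (psh_times P K) (psh_times Q K)"
proof -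
  have PQ: "P \<in> Ob sPSh" "Q \<in> Ob sPSh" "src f = P" "tgt f = Q"
    using category_ends[OF category_sPSh f] f by (auto simp: hom_def)
  show ?thesis
    unfolding psh_times_map_def PQ(3,4)
  proof (rule mk_spsh_map_hom[OF psh_times_Ob[OF PQ(1) K] psh_times_Ob[OF PQ(2) K]], goal_cases)
    case (1 U n z)
    then show ?case using spsh_map_in[OF f] by auto
  next
    case (2 U t z)
    then obtain x k where "z = Pr x k" "x \<in> obj_of (obj_of P U) (tgt t)" "k \<in> obj_of K (tgt t)"
      by auto
    then show ?case using sset_map_natural[OF spsh_map_component[OF f] 2(1)] spsh_map_in[OF f]
      by (simp add: psh_times_acts)
  next
    case (3 a n z)
    then obtain x k where "z = Pr x k" "x \<in> obj_of (obj_of P (tgt a)) n" "k \<in> obj_of K n"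
      by auto
    then show ?case using spsh_map_natural[OF f 3(1)] spsh_map_in[OF f]
      by (simp add: psh_times_acts)
  qed
qed

section \<open>The initial sheaf\<close>

text \<open>\<open>[0]\<close> is the 0-dimensional ball, i.e. the one-point manifold. A presheaf
  with sections over the empty manifold \<open>[]\<close> only counts as not inhabited.\<close>

definition inhabited :: "spsh \<Rightarrow> bool" where
  "inhabited P \<longleftrightarrow> obj_of (obj_of P [0]) 0 \<noteq> {}"

lemma zero_in_unit_ball: "(\<lambda>_. 0) \<in> unit_ball n"
  by (simp add: unit_ball_def topspace_Euclidean_space)

lemma points_empty_iff [simp]: "points U = {} \<longleftrightarrow> U = []"
  using zero_in_unit_ball by (cases U) (auto simp: points_def)

lemma Ar_Site:
  "a \<in> Ar Site \<longleftrightarrow> fn a \<in> smooth_maps (src a) (tgt a) \<and> fn a \<in> points (src a) \<rightarrow>\<^sub>E points (tgt a)"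
  by (simp add: Site_def Ar_concrete_cat)

lemma Site_tgt_Nil:
  assumes "a \<in> Ar Site" "tgt a = []"
  shows "src a = []"
proof -
  have "points [] = {}" by simp
  then have "points (src a) = {}" using assms by (fastforce simp: Ar_Site)
  then show ?thesis by simp
qed

text \<open>In dimension 0 the derivative clause of \<open>C_diff\<close> ranges over no
  coordinates, which leaves continuity at order 0.\<close>

lemma C_diff_const_0_dim:
  assumes "\<And>x. x \<in> S \<Longrightarrow> f x = c"
  shows "C_diff k 0 S f"
proof (cases k)
  case 0
  have "continuous_map (subtopology (Euclidean_space 0) S) euclideanreal f"
    by (rule continuous_map_eq[of _ _ "\<lambda>_. c"]) (use assms in auto)
  then show ?thesis using 0 by simp
qed simp

text \<open>The constant map at any point of \<open>U\<close>; its smoothness is trivial because its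
  source has dimension 0.\<close>

lemma ex_point_arrow:
  assumes "U \<noteq> []"
  shows "\<exists>a\<in>Ar Site. src a = [0] \<and> tgt a = U"
proof -
  obtain p where p: "p \<in> points U" using assms by (metis ex_in_conv points_empty_iff)
  define f where "f = (\<lambda>z\<in>points [0]. p)"
  have f: "f (0, x) = p" if "x \<in> unit_ball 0" for x
    using that by (simp add: f_def points_def)
  have "f \<in> smooth_maps [0] U"
    unfolding smooth_maps_def
  proof (intro CollectI conjI allI impI)
    show "f \<in> points [0] \<rightarrow> points U" using p by (auto simp: f_def)
    fix i assume "i < length [0::nat]"
    then have [simp]: "i = 0" by simp
    have "smooth 0 (U ! fst p) (unit_ball 0) (\<lambda>x. snd (f (0, x)))"
      unfolding smooth_def by (intro allI impI C_diff_const_0_dim) (simp add: f)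
    then show "\<exists>j<length U. (\<forall>x\<in>unit_ball ([0] ! i). fst (f (i, x)) = j) \<and>
        smooth ([0] ! i) (U ! j) (unit_ball ([0] ! i)) (\<lambda>x. snd (f (i, x)))"
      using p by (intro exI[of _ "fst p"]) (auto simp: points_def f)
  qed
  moreover have "f \<in> points [0] \<rightarrow>\<^sub>E points U" using p by (auto simp: f_def)
  ultimately show ?thesis by (intro bexI[of _ "Arr [0] f U"]) (simp_all add: Ar_Site)
qed

lemma ex_vertex_arrow: "\<exists>t\<in>Ar Simplex. src t = 0 \<and> tgt t = n"
  by (rule bexI[of _ "Arr 0 (\<lambda>_\<in>{..0}. 0) n"])
     (auto simp: Simplex_def Ar_concrete_cat mono_on_def)

lemma sset_empty: "X \<in> Ob sSet \<Longrightarrow> obj_of X 0 = {} \<Longrightarrow> obj_of X n = {}"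
  using ex_vertex_arrow[of n] simp_act_in[of X] by fastforce

text \<open>A simplex over \<open>U\<close> would restrict along a point of \<open>U\<close> to one
  over \<open>[0]\<close>, and every simplex there has a vertex.\<close>

lemma not_inhabited_empty:
  assumes P: "P \<in> Ob sPSh" and "\<not> inhabited P" and U: "U \<noteq> []"
  shows "obj_of (obj_of P U) n = {}"
proof -
  have "obj_of (obj_of P [0]) n = {}"
    using sset_empty[OF spsh_obj[OF P]] assms(2) by (auto simp: inhabited_def)
  with ex_point_arrow[OF U] site_act_in[OF P] show ?thesis by fastforce
qed

text \<open>The empty sieve covers the empty manifold \<open>[]\<close>, so a sheaf must have a point there.\<close>

definition initial_sheaf :: spsh where
  "initial_sheaf = mk_spsh (\<lambda>U n. if U = [] then {SiteArr undefined} else {}) (\<lambda>a n z. z) (\<lambda>U t z. z)"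

lemma initial_sheaf_Ob: "initial_sheaf \<in> Ob sPSh"
  unfolding initial_sheaf_def by (rule mk_spsh_Ob) (auto split: if_splits dest: Site_tgt_Nil)

lemma initial_sheaf_not_inhabited: "\<not> inhabited initial_sheaf"
  by (simp add: initial_sheaf_def inhabited_def)

lemma initial_sheaf_elems:
  "x \<in> obj_of (obj_of initial_sheaf U) n \<longleftrightarrow> U = [] \<and> x = SiteArr undefined"
  by (simp add: initial_sheaf_def)

text \<open>The target has at most one simplex over each manifold in each dimension.\<close>

lemma hom_initial_sheaf_unique:
  assumes "f \<in> hom sPSh P initial_sheaf" "g \<in> hom sPSh P initial_sheaf"
  shows "f = g"
  by (rule spsh_map_eqI[OF assms])
     (use spsh_map_in[OF assms(1)] spsh_map_in[OF assms(2)] in \<open>simp add: initial_sheaf_elems\<close>)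

lemma hom_initial_sheaf_ex:
  assumes P: "P \<in> Ob sPSh" and "\<not> inhabited P"
  shows "\<exists>f. f \<in> hom sPSh P initial_sheaf"
proof -
  have U: "U = []" if "x \<in> obj_of (obj_of P U) n" for U n x
    using not_inhabited_empty[OF assms, of U n] that by blast
  let ?m = "\<lambda>U n z. SiteArr undefined"
  have "mk_spsh_map P initial_sheaf ?m \<in> hom sPSh P initial_sheaf"
  proof (rule mk_spsh_map_hom[OF P initial_sheaf_Ob], goal_cases)
    case (1 U n x)
    then show ?case using U by (simp add: initial_sheaf_elems)
  next
    case (2 U t x)
    then show ?case using U[OF 2(2)] by (simp add: initial_sheaf_def)
  next
    case (3 a n x)
    then show ?case using U[OF 3(2)] by (simp add: initial_sheaf_def)
  qed
  then show ?thesis by blast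
qed

section \<open>Zigzags of presheaves ending in the initial sheaf\<close>

definition empty_sset :: sset where
  "empty_sset = mk_sset (\<lambda>_. {}) (\<lambda>_ z. z)"

text \<open>A horn has at least one face, because the simplex to be filled has dimension at least 1.
  Hence there is no horn in the empty simplicial set.\<close>

lemma Kan_empty_sset: "Kan empty_sset"
  unfolding Kan_def
proof (intro conjI allI impI)
  show "empty_sset \<in> Ob sSet" unfolding empty_sset_def by (rule mk_sset_Ob) auto
  fix n k :: nat and z
  assume "\<forall>i\<le>Suc n. i \<noteq> k \<longrightarrow> z i \<in> obj_of empty_sset n"
  moreover have "\<exists>i\<le>Suc n. i \<noteq> k" by (intro exI[of _ "if k = 0 then 1 else 0"]) auto
  ultimately show "\<exists>w\<in>obj_of empty_sset (Suc n).
      \<forall>i\<le>Suc n. i \<noteq> k \<longrightarrow> simp_act empty_sset (coface n i) w = z i"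
    by (auto simp: empty_sset_def)
qed

text \<open>The definition of \<open>weak_eq\<close> is tested on the empty Kan complex: if
  \<open>X\<close> is empty it maps there, and surjectivity on homotopy classes produces a map from
  \<open>Y\<close> as well.\<close>

lemma weak_eq_empty:
  assumes "weak_eq f" and f: "f \<in> hom sSet X Y" and "obj_of X 0 = {}"
  shows "obj_of Y 0 = {}"
proof -
  have X: "X \<in> Ob sSet" using category_ends[OF category_sSet f] by simp
  have E: "empty_sset \<in> Ob sSet" using Kan_empty_sset by (simp add: Kan_def)
  have ends: "src f = X" "tgt f = Y" using f by (auto simp: hom_def)
  have "\<forall>h\<in>hom sSet X empty_sset. \<exists>g\<in>hom sSet Y empty_sset. homotopic (Comp sSet g f) h"
    using assms(1) Kan_empty_sset unfolding weak_eq_def ends by blast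
  moreover have "mk_sset_map X empty_sset (\<lambda>_ z. z) \<in> hom sSet X empty_sset"
    by (rule mk_sset_map_hom[OF X E]) (use sset_empty[OF X assms(3)] in auto)
  ultimately obtain g where "g \<in> hom sSet Y empty_sset" by blast
  from sset_map_in[OF this, of _ 0] show ?thesis by (auto simp: empty_sset_def)
qed

lemma inhabited_map: "f \<in> hom sPSh P Q \<Longrightarrow> inhabited P \<Longrightarrow> inhabited Q"
  unfolding inhabited_def using spsh_map_in[of f P Q _ "[0]" 0] by blast

text \<open>Forward steps carry a vertex over \<open>[0]\<close> along. For a backward step,
  \<open>weak_eq_empty\<close> at \<open>[0]\<close> excludes an empty source.\<close>

lemma zigzag_inhabited:
  "zigzag sPSh psh_weq P p Q \<Longrightarrow> inhabited P \<Longrightarrow> inhabited Q"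
proof (induction p arbitrary: P)
  case (Cons s p)
  show ?case
  proof (cases s)
    case (Fwd a)
    then show ?thesis using Cons inhabited_map[OF hom_self, of a] by auto
  next
    case (Bwd a)
    then have a: "a \<in> Ar sPSh" "weak_eq (fn a [0])" "tgt a = P"
      using Cons.prems by (auto simp: psh_weq_def)
    have "inhabited (src a)"
      using weak_eq_empty[OF a(2) spsh_map_component[OF hom_self[OF a(1)]]] a(3) Cons.prems(2)
      unfolding inhabited_def by blast
    then show ?thesis using Cons Bwd by auto
  qed
qed simp

text \<open>No object on the way can be inhabited, so each has its unique honest map to the initial
  sheaf. By induction the tail of the zigzag collapses to that map, and the first step is then
  absorbed into it.\<close>

lemma zigzag_initial_sheaf_unique:
  assumes "zigzag sPSh psh_weq P p initial_sheaf" "f \<in> hom sPSh P initial_sheaf"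
  shows "zz_equiv sPSh psh_weq P initial_sheaf p [Fwd f]"
  using assms
proof (induction p arbitrary: P f)
  case Nil
  then have [simp]: "P = initial_sheaf" by simp
  have "f = Ide sPSh initial_sheaf"
    using hom_initial_sheaf_unique Nil(2) category_Ide[OF category_sPSh initial_sheaf_Ob] by simp
  then have "zz_equiv sPSh psh_weq P initial_sheaf [Fwd f] []"
    using Nil(2) initial_sheaf_Ob by (intro zz_equiv_relation) (auto simp: zz_relations_def hom_def)
  then show ?case by (rule equivclp_sym)
next
  case (Cons s p)
  note C = category_sPSh
  have Z: "zigzag sPSh psh_weq initial_sheaf [] initial_sheaf" using initial_sheaf_Ob by simp
  show ?case
  proof (cases s)
    case (Fwd a)
    then have a: "a \<in> hom sPSh P (tgt a)" and p: "zigzag sPSh psh_weq (tgt a) p initial_sheaf"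
      using Cons.prems by (auto simp: hom_def)
    \<comment> \<open>The rest of the zigzag would transport an inhabitant of \<open>tgt a\<close>
      into the initial sheaf.\<close>
    have "\<not> inhabited (tgt a)" using zigzag_inhabited[OF p] initial_sheaf_not_inhabited by blast
    then obtain g where g: "g \<in> hom sPSh (tgt a) initial_sheaf"
      using hom_initial_sheaf_ex category_ends[OF C a] by blast
    have f: "f = Comp sPSh g a"
      by (rule hom_initial_sheaf_unique[OF Cons.prems(2) category_Comp[OF C a g]])
    have za: "zigzag sPSh psh_weq P [Fwd a] (tgt a)"
      using a category_ends[OF C a] by (auto simp: hom_def)
    have "zz_equiv sPSh psh_weq P initial_sheaf (Fwd a # p) [Fwd a, Fwd g]"
      using zz_equiv_context[OF C Cons.IH[OF p g] za Z] by simp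
    moreover have "zz_equiv sPSh psh_weq P initial_sheaf [Fwd a, Fwd g] [Fwd f]"
      using a g Cons.prems(2) initial_sheaf_Ob unfolding f
      by (intro zz_equiv_relation) (auto simp: zz_relations_def hom_def)
    ultimately show ?thesis unfolding Fwd by (rule equivclp_trans)
  next
    case (Bwd a)
    then have a: "a \<in> hom sPSh (src a) P" "a \<in> psh_weq" "a \<in> Ar sPSh" "tgt a = P"
      and p: "zigzag sPSh psh_weq (src a) p initial_sheaf"
      using Cons.prems by (auto simp: hom_def)
    \<comment> \<open>With this choice \<open>[Bwd a, Fwd g]\<close> expands to
      \<open>[Bwd a, Fwd a, Fwd f]\<close>, where the first two steps cancel.\<close>
    define g where "g = Comp sPSh f a"
    have g: "g \<in> hom sPSh (src a) initial_sheaf"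
      unfolding g_def by (rule category_Comp[OF C a(1) Cons.prems(2)])
    have f: "f \<in> Ar sPSh" "src f = P" "tgt f = initial_sheaf" using Cons.prems(2) by (auto simp: hom_def)
    have ob: "src a \<in> Ob sPSh" "P \<in> Ob sPSh" using category_ends[OF C a(1)] by auto
    have za: "zigzag sPSh psh_weq P [Bwd a] (src a)" using a ob by simp
    have zf: "zigzag sPSh psh_weq P [Fwd f] initial_sheaf" using f initial_sheaf_Ob by simp
    have zp: "zigzag sPSh psh_weq P [] P" using ob by simp
    have 1: "zz_equiv sPSh psh_weq P initial_sheaf (Bwd a # p) [Bwd a, Fwd g]"
      using zz_equiv_context[OF C Cons.IH[OF p g] za Z] by simp
    have "zz_equiv sPSh psh_weq (src a) initial_sheaf [Fwd a, Fwd f] [Fwd g]"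
      using a f g initial_sheaf_Ob unfolding g_def
      by (intro zz_equiv_relation) (auto simp: zz_relations_def hom_def)
    from zz_equiv_context[OF C this za Z]
    have 2: "zz_equiv sPSh psh_weq P initial_sheaf [Bwd a, Fwd a, Fwd f] [Bwd a, Fwd g]" by simp
    have "zz_equiv sPSh psh_weq P P [Bwd a, Fwd a] []"
      using a ob by (intro zz_equiv_relation) (auto simp: zz_relations_def)
    from zz_equiv_context[OF C this zp zf]
    have 3: "zz_equiv sPSh psh_weq P initial_sheaf [Bwd a, Fwd a, Fwd f] [Fwd f]" by simp
    show ?thesis unfolding Bwd by (rule equivclp_trans[OF 1 equivclp_trans[OF equivclp_sym[OF 2] 3]])
  qed
qed

lemma hom_HoPSh_initial_sheaf:
  assumes P: "P \<in> Ob sPSh" and ni: "\<not> inhabited P"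
  obtains h where "hom HoPSh P initial_sheaf = {h}"
proof -
  obtain f where f: "f \<in> hom sPSh P initial_sheaf" using hom_initial_sheaf_ex[OF assms] by blast
  have "hom HoPSh P initial_sheaf =
      {Arr P (zz_class sPSh psh_weq P initial_sheaf [Fwd f]) initial_sheaf}" (is "?A = {?a}")
  proof (intro equalityI subsetI)
    fix b assume "b \<in> ?A"
    then show "b \<in> {?a}"
      unfolding HoPSh_def hom_localization[OF category_sPSh]
      using zz_class_eqI[OF zigzag_initial_sheaf_unique[OF _ f]] by auto
  next
    fix b assume "b \<in> {?a}"
    then show "b \<in> ?A"
      unfolding HoPSh_def hom_localization[OF category_sPSh]
      using f initial_sheaf_Ob by (auto simp: hom_def[of sPSh] intro!: exI[of _ "[Fwd f]"])
  qed
  then show ?thesis using that by blast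
qed

lemma hom_HoPSh_initial_sheaf_inhabited:
  "inhabited P \<Longrightarrow> hom HoPSh P initial_sheaf = {}"
  unfolding HoPSh_def hom_localization[OF category_sPSh]
  using zigzag_inhabited initial_sheaf_not_inhabited
  by (auto simp: set_eq_iff hom_localization[OF category_sPSh])

section \<open>Sieves and the sheaf condition for the initial sheaf\<close>

lemma Site_Comp_Ide: "a \<in> Ar Site \<Longrightarrow> Comp Site a (Ide Site (src a)) = a"
  by (cases a) (auto simp: Site_def Ar_concrete_cat fun_eq_iff compose_def PiE_def extensional_def)

lemma Site_assoc:
  "c \<in> Ar Site \<Longrightarrow> tgt c = src b \<Longrightarrow> Comp Site (Comp Site a b) c = Comp Site a (Comp Site b c)"
  by (auto simp: Site_def Ar_concrete_cat fun_eq_iff compose_def PiE_def Pi_def)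

text \<open>Closure under precomposition is part of \<open>sieve\<close>, so the presheaf laws
  reduce to the unit and associativity laws for composites.\<close>

lemma sieve_psh_Ob: "sieve U R \<Longrightarrow> sieve_psh R \<in> Ob sPSh"
  unfolding sieve_psh_def
  by (rule mk_spsh_Ob) (auto simp: sieve_def Site_Comp_Ide Site_assoc)

lemma obj_of_sieve_psh [simp]: "obj_of (obj_of (sieve_psh R) V) n = SiteArr ` {a \<in> R. src a = V}"
  by (simp add: sieve_psh_def)

lemma sieve_inclusion_ends [simp]:
  "src (sieve_inclusion U R) = sieve_psh R"
  "tgt (sieve_inclusion U R) = sieve_psh {a \<in> Ar Site. tgt a = U}"
  by (simp_all add: sieve_inclusion_def)

lemma sieve_inclusion_hom:
  assumes R: "sieve U R" and F: "sieve U {a \<in> Ar Site. tgt a = U}"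
  shows "sieve_inclusion U R \<in> hom sPSh (sieve_psh R) (sieve_psh {a \<in> Ar Site. tgt a = U})"
  unfolding sieve_inclusion_def
proof (rule mk_spsh_map_hom[OF sieve_psh_Ob[OF R] sieve_psh_Ob[OF F]])
qed (use R in \<open>auto simp: sieve_def sieve_psh_def\<close>)

text \<open>Everything that maps to the empty manifold is empty, so the composites are empty
  functions and vacuously smooth.\<close>

lemma maximal_sieve_Nil: "sieve [] {a \<in> Ar Site. tgt a = []}"
proof -
  have "Comp Site a b \<in> Ar Site" if "a \<in> Ar Site" "tgt a = []" "b \<in> Ar Site" "tgt b = src a" for a b
  proof -
    have "src a = []" "src b = []" using that Site_tgt_Nil by auto
    then show ?thesis using that(2)
      by (auto simp: Ar_Site smooth_maps_def) (auto simp: Site_def compose_def extensional_def points_def)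
  qed
  then show ?thesis by (auto simp: sieve_def)
qed

definition empty_spsh :: spsh where
  "empty_spsh = mk_spsh (\<lambda>_ _. {}) (\<lambda>_ _ z. z) (\<lambda>_ _ z. z)"

lemma empty_spsh_Ob: "empty_spsh \<in> Ob sPSh"
  unfolding empty_spsh_def by (rule mk_spsh_Ob) auto

text \<open>This is a literal equality and not just an isomorphism: all structure maps are
  restricted to the carriers, which are empty.\<close>

lemma psh_times_empty:
  assumes "\<And>n. obj_of K n = {}"
  shows "psh_times P K = empty_spsh"
  using assms
  by (simp add: psh_times_def empty_spsh_def mk_spsh_def mk_sset_def mk_sset_map_def Let_def
      restrict_def fun_eq_iff)

text \<open>
  The hypothesis leaves only \<open>U = []\<close> and \<open>K\<close> empty; otherwise the maximal sieve would have to be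
  known to be a sieve, i.e. smooth maps to be closed under composition.
\<close>

lemma sieve_times_map_hom:
  assumes R: "sieve U R" and K: "K \<in> Ob sSet"
    and ni: "\<not> inhabited (psh_times (sieve_psh {a \<in> Ar Site. tgt a = U}) K)"
  shows "psh_times_map (sieve_inclusion U R) K \<in>
    hom sPSh (psh_times (sieve_psh R) K) (psh_times (sieve_psh {a \<in> Ar Site. tgt a = U}) K)"
proof (cases "U = []")
  case True
  show ?thesis
    using psh_times_map_hom[OF sieve_inclusion_hom[OF R] K] maximal_sieve_Nil True by simp
next
  case False
  have "obj_of K 0 = {}" using ni ex_point_arrow[OF False] by (auto simp: inhabited_def)
  then have K0: "obj_of K n = {}" for n using sset_empty[OF K] by simp
  show ?thesis
    unfolding psh_times_map_def sieve_inclusion_ends psh_times_empty[of K, OF K0]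
    by (rule mk_spsh_map_hom[OF empty_spsh_Ob empty_spsh_Ob]) (simp_all add: empty_spsh_def)
qed

text \<open>Each of the two hom sets is empty or a singleton, according to whether its source is
  inhabited. So it is enough that the sieve times \<open>K\<close> is inhabited exactly when the
  representable times \<open>K\<close> is; a map between singletons is bijective.\<close>

lemma is_sheaf_initial_sheaf: "is_sheaf initial_sheaf"
  unfolding is_sheaf_def
proof (intro conjI ballI allI impI initial_sheaf_Ob)
  fix U R assume c: "covering_sieve U R"
  define F where "F = {a \<in> Ar Site. tgt a = U}"
  have R: "sieve U R" using c by (simp add: covering_sieve_def)
  show "map_equivalence (sieve_inclusion U R) initial_sheaf"
    unfolding map_equivalence_def sieve_inclusion_ends F_def[symmetric]
  proof
    fix K assume K: "K \<in> Ob sSet"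
    let ?X = "psh_times (sieve_psh R) K" and ?Y = "psh_times (sieve_psh F) K"
    let ?m = "\<lambda>h. Comp HoPSh h (loc_arr sPSh psh_weq (psh_times_map (sieve_inclusion U R) K))"
    have inh: "inhabited ?X \<longleftrightarrow> inhabited ?Y"
    proof
      assume "inhabited ?X"
      then show "inhabited ?Y" using R by (auto simp: inhabited_def sieve_def F_def)
    next
      assume Y: "inhabited ?Y"
      then obtain a k where a: "a \<in> Ar Site" "tgt a = U" "src a = [0]" and k: "k \<in> obj_of K 0"
        by (auto simp: inhabited_def F_def)
      \<comment> \<open>A nonempty \<open>U\<close> has a point, some member \<open>b\<close> of the
        covering sieve hits it, and precomposing \<open>b\<close> with a point of its source gives
        an element of the sieve over \<open>[0]\<close>.\<close>
      have "U \<noteq> []" using Site_tgt_Nil[OF a(1)] a by auto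
      then obtain q where "q \<in> points U" by (metis ex_in_conv points_empty_iff)
      then obtain b where b: "b \<in> R" "q \<in> fn b ` points (src b)"
        using c by (auto simp: covering_sieve_def)
      then have "src b \<noteq> []" using points_empty_iff[of "src b"] by blast
      then obtain d where d: "d \<in> Ar Site" "src d = [0]" "tgt d = src b"
        using ex_point_arrow by blast
      then have "Comp Site b d \<in> R" using b R by (auto simp: sieve_def)
      then have "Pr (SiteArr (Comp Site b d)) k \<in> obj_of (obj_of ?X [0]) 0" using k d by auto
      then show "inhabited ?X" unfolding inhabited_def by blast
    qed
    show "bij_betw ?m (hom HoPSh ?Y initial_sheaf) (hom HoPSh ?X initial_sheaf)"
    proof (cases "inhabited ?Y")
      case True
      then show ?thesis using inh by (simp add: hom_HoPSh_initial_sheaf_inhabited bij_betw_def)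
    next
      case False
      have m: "psh_times_map (sieve_inclusion U R) K \<in> hom sPSh ?X ?Y"
        using sieve_times_map_hom[OF R K] False by (simp add: F_def)
      have ob: "?X \<in> Ob sPSh" "?Y \<in> Ob sPSh" using category_ends[OF category_sPSh m] by auto
      obtain h where h: "hom HoPSh ?X initial_sheaf = {h}"
        using hom_HoPSh_initial_sheaf[OF ob(1)] False inh by blast
      obtain h' where h': "hom HoPSh ?Y initial_sheaf = {h'}"
        using hom_HoPSh_initial_sheaf[OF ob(2)] False by blast
      have "?m h' \<in> hom HoPSh ?X initial_sheaf"
        using loc_arr_hom[OF category_sPSh m, of psh_weq] h'
        unfolding HoPSh_def by (intro localization_Comp_hom[OF category_sPSh]) auto
      then show ?thesis unfolding h h' by (simp add: bij_betw_def)
    qed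
  qed
qed

section \<open>Local equivalences and arrows of the homotopy category\<close>

text \<open>Taken as \<open>K\<close> in \<open>map_equivalence\<close>, it extracts the comparison
  of plain hom sets. \<open>SiteArr undefined\<close> is an arbitrary label for the single simplex
  in each dimension, as in \<open>initial_sheaf\<close>.\<close>

definition point_sset :: sset where
  "point_sset = mk_sset (\<lambda>_. {SiteArr undefined}) (\<lambda>_ z. z)"

lemma point_sset_Ob: "point_sset \<in> Ob sSet"
  unfolding point_sset_def by (rule mk_sset_Ob) auto

lemma inhabited_times_point: "inhabited (psh_times P point_sset) \<longleftrightarrow> inhabited P"
  by (auto simp: inhabited_def point_sset_def)

text \<open>Otherwise composition with \<open>f\<close> would be a bijection from the empty set of
  arrows out of \<open>Q\<close> to the singleton of arrows out of \<open>P\<close>, both taken into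
  the initial sheaf and up to a product with the point.\<close>

lemma local_eq_inhabited:
  assumes "f \<in> local_eq" and f: "f \<in> hom sPSh P Q" and "inhabited Q"
  shows "inhabited P"
proof (rule ccontr)
  assume "\<not> inhabited P"
  then have "\<not> inhabited (psh_times P point_sset)" by (simp add: inhabited_times_point)
  moreover have "psh_times P point_sset \<in> Ob sPSh"
    using category_ends[OF category_sPSh f] point_sset_Ob by (intro psh_times_Ob) auto
  ultimately obtain h where "hom HoPSh (psh_times P point_sset) initial_sheaf = {h}"
    by (metis hom_HoPSh_initial_sheaf)
  moreover have "hom HoPSh (psh_times Q point_sset) initial_sheaf = {}"
    using assms(3) by (simp add: hom_HoPSh_initial_sheaf_inhabited inhabited_times_point)
  moreover have "map_equivalence f initial_sheaf" "src f = P" "tgt f = Q"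
    using assms is_sheaf_initial_sheaf by (auto simp: local_eq_def hom_def)
  ultimately show False using point_sset_Ob by (auto simp: map_equivalence_def bij_betw_def)
qed

text \<open>Evaluation at \<open>A\<close> turns each step into a map of presheaves, and each
  backward step into a local equivalence.\<close>

lemma HQ_zigzag_inhabited:
  assumes A: "A \<in> Ob Alg"
  shows "zigzag HQpre HQ_weq F p G \<Longrightarrow> inhabited (obj_of F A) \<Longrightarrow> inhabited (obj_of G A)"
proof (induction p arbitrary: F)
  case (Cons s p)
  have component: "fn a A \<in> hom sPSh (obj_of (src a) A) (obj_of (tgt a) A)" if "a \<in> Ar HQpre" for a
    using hom_Fun_component[OF hom_self[OF that[unfolded HQpre_def]] A] by simp
  show ?case
  proof (cases s)
    case (Fwd a)
    then show ?thesis using Cons inhabited_map[OF component] by auto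
  next
    case (Bwd a)
    then show ?thesis using Cons local_eq_inhabited[OF _ component] A by (auto simp: HQ_weq_def)
  qed
qed simp

lemma hom_HQ_inhabited:
  assumes "c \<in> hom HQ F G" "A \<in> Ob Alg" "inhabited (obj_of F A)"
  shows "inhabited (obj_of G A)"
  using assms HQ_zigzag_inhabited by (auto simp: HQ_def hom_def localization_def)

section \<open>Matrix algebras and tensor products\<close>

text \<open>The abstract C*-identity. Since \<open>f v \<bullet> f v = v \<bullet> g (f v)\<close>,
  Cauchy-Schwarz bounds the square of the norm of \<open>f\<close> by that of
  \<open>g \<circ> f\<close>, hence by the product of both norms. Cancelling gives one inequality
  between the norms of \<open>f\<close> and \<open>g\<close>, and symmetry the other.\<close>

lemma onorm_comp_adjoint:
  fixes f g :: "'a :: real_inner \<Rightarrow> 'a"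
  assumes f: "bounded_linear f" and g: "bounded_linear g" and adj: "\<And>v w. f v \<bullet> w = v \<bullet> g w"
  shows "onorm (g \<circ> f) = (onorm f)\<^sup>2"
proof -
  have le: "(onorm f)\<^sup>2 \<le> onorm (g \<circ> f)"
    if f: "bounded_linear f" and g: "bounded_linear g" and adj: "\<And>v w. f v \<bullet> w = v \<bullet> g w"
    for f g :: "'a \<Rightarrow> 'a"
  proof -
    have gf: "bounded_linear (g \<circ> f)" using bounded_linear_compose[OF g f] by (simp add: comp_def)
    have "norm (f v) \<le> sqrt (onorm (g \<circ> f)) * norm v" for v
    proof (rule power2_le_imp_le)
      have "(norm (f v))\<^sup>2 = v \<bullet> (g \<circ> f) v" by (simp add: power2_norm_eq_inner adj)
      also have "\<dots> \<le> norm v * norm ((g \<circ> f) v)" by (rule norm_cauchy_schwarz)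
      also have "\<dots> \<le> norm v * (onorm (g \<circ> f) * norm v)"
        by (rule mult_left_mono[OF onorm[OF gf]]) simp
      finally show "(norm (f v))\<^sup>2 \<le> (sqrt (onorm (g \<circ> f)) * norm v)\<^sup>2"
        using onorm_pos_le[OF gf] by (simp add: power_mult_distrib power2_eq_square mult_ac)
    qed (simp add: onorm_pos_le[OF gf])
    then have "onorm f \<le> sqrt (onorm (g \<circ> f))"
      using onorm_pos_le[OF gf] by (intro onorm_bound) auto
    from power_mono[OF this onorm_pos_le[OF f], of 2] show ?thesis
      using onorm_pos_le[OF gf] by simp
  qed
  have le': "onorm f \<le> onorm g"
    if f: "bounded_linear f" and g: "bounded_linear g" and adj: "\<And>v w. f v \<bullet> w = v \<bullet> g w"
    for f g :: "'a \<Rightarrow> 'a"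
  proof -
    have "onorm f * onorm f \<le> onorm g * onorm f"
      using le[OF that] onorm_compose[OF g f] by (simp add: power2_eq_square)
    then show ?thesis
      using onorm_pos_le[OF f] onorm_pos_le[OF g] by (cases "onorm f = 0") auto
  qed
  have adj': "g v \<bullet> w = v \<bullet> f w" for v w using adj[of w v] by (simp add: inner_commute)
  have "onorm f = onorm g" using le'[OF f g adj] le'[OF g f adj'] by simp
  then show ?thesis
    using le[OF f g adj] onorm_compose[OF g f] by (simp add: power2_eq_square)
qed

definition mat2 :: "complex \<Rightarrow> complex \<Rightarrow> complex \<Rightarrow> complex \<Rightarrow> nat \<Rightarrow> complex" where
  "mat2 a b c d = (\<lambda>i. if i = 0 then a else if i = 1 then b else if i = 2 then c else if i = 3 then d else 0)"

text \<open>The entries are stored row by row. The norm on pairs is the Euclidean one, so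
  \<open>onorm\<close> of this action is the usual operator norm.\<close>

definition mat2_apply :: "(nat \<Rightarrow> complex) \<Rightarrow> complex \<times> complex \<Rightarrow> complex \<times> complex" where
  "mat2_apply x v = (x 0 * fst v + x 1 * snd v, x 2 * fst v + x 3 * snd v)"

definition M2 :: fd_alg where
  "M2 = \<lparr>adim = 4,
     mul = (\<lambda>x y. mat2 (x 0 * y 0 + x 1 * y 2) (x 0 * y 1 + x 1 * y 3)
                       (x 2 * y 0 + x 3 * y 2) (x 2 * y 1 + x 3 * y 3)),
     star = (\<lambda>x. mat2 (cnj (x 0)) (cnj (x 2)) (cnj (x 1)) (cnj (x 3))),
     one = mat2 1 0 0 1,
     nrm = (\<lambda>x. onorm (mat2_apply x))\<rparr>"

lemma mat2_simps [simp]: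
  "mat2 a b c d 0 = a" "mat2 a b c d 1 = b" "mat2 a b c d (Suc 0) = b" "mat2 a b c d 2 = c" "mat2 a b c d 3 = d"
  by (simp_all add: mat2_def)

lemma mat2_eq_iff [simp]: "mat2 a b c d = mat2 a' b' c' d' \<longleftrightarrow> a = a' \<and> b = b' \<and> c = c' \<and> d = d'"
  by (metis mat2_simps)

lemma mat2_ops [simp]:
  "(\<lambda>i. mat2 a b c d i + mat2 a' b' c' d' i) = mat2 (a + a') (b + b') (c + c') (d + d')"
  "(\<lambda>i. z * mat2 a b c d i) = mat2 (z * a) (z * b) (z * c) (z * d)"
  by (auto simp: mat2_def fun_eq_iff)

lemma mat2_zero: "mat2 0 0 0 0 = (\<lambda>_. 0)"
  by (simp add: mat2_def fun_eq_iff)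

lemma M2_simps [simp]:
  "mul M2 (mat2 a b c d) (mat2 a' b' c' d') =
     mat2 (a * a' + b * c') (a * b' + b * d') (c * a' + d * c') (c * b' + d * d')"
  "star M2 (mat2 a b c d) = mat2 (cnj a) (cnj c) (cnj b) (cnj d)"
  "one M2 = mat2 1 0 0 1"
  "nrm M2 x = onorm (mat2_apply x)"
  by (simp_all add: M2_def)

lemma mat2_in_vecs [simp]: "mat2 a b c d \<in> vecs M2"
  by (simp add: vecs_def M2_def mat2_def)

lemma vecs_M2: "x \<in> vecs M2 \<Longrightarrow> x = mat2 (x 0) (x 1) (x 2) (x 3)"
  by (auto simp: vecs_def M2_def mat2_def fun_eq_iff)

lemma vecs_M2_cases: "x \<in> vecs M2 \<Longrightarrow> (\<And>a b c d. x = mat2 a b c d \<Longrightarrow> P) \<Longrightarrow> P"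
  using vecs_M2 by blast

text \<open>Turns the axioms for \<open>M2\<close> into polynomial identities in the matrix entries
  and their conjugates.\<close>

lemma ball_vecs_M2: "(\<forall>x\<in>vecs M2. P x) \<longleftrightarrow> (\<forall>a b c d. P (mat2 a b c d))"
  by (metis vecs_M2_cases mat2_in_vecs)

lemma is_star_algebra_M2: "is_star_algebra M2"
  unfolding is_star_algebra_def ball_vecs_M2 by (simp add: algebra_simps)

lemma bounded_linear_mat2_apply: "bounded_linear (mat2_apply x)"
  unfolding mat2_apply_def
  by (intro bounded_linear_Pair bounded_linear_add bounded_linear_const_mult
      bounded_linear_fst bounded_linear_snd)

lemma mat2_apply_mul: "mat2_apply (mul M2 x y) = mat2_apply x \<circ> mat2_apply y"
  by (auto simp: mat2_apply_def M2_def fun_eq_iff algebra_simps)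

text \<open>The inner product here is the real part of the Hermitian one, and the conjugate
  transpose is still adjoint for it.\<close>

lemma mat2_apply_adjoint: "mat2_apply x v \<bullet> w = v \<bullet> mat2_apply (star M2 x) w"
  by (simp add: mat2_apply_def M2_def inner_prod_def inner_complex_def algebra_simps)

text \<open>One inequality suffices: for \<open>z \<noteq> 0\<close> its instance for
  \<open>inverse z\<close> and the scaled matrix is the reverse one.\<close>

lemma onorm_mat2_scale: "onorm (mat2_apply (\<lambda>i. z * x i)) = cmod z * onorm (mat2_apply x)"
proof -
  have n: "norm (mat2_apply (\<lambda>i. z * x i) v) = cmod z * norm (mat2_apply x v)" for z x v
  proof -
    have "mat2_apply (\<lambda>i. z * x i) v = (z * fst (mat2_apply x v), z * snd (mat2_apply x v))"
      by (simp add: mat2_apply_def algebra_simps)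
    then show ?thesis
      by (simp add: norm_prod_def norm_mult power_mult_distrib real_sqrt_mult flip: distrib_left)
  qed
  have le: "onorm (mat2_apply (\<lambda>i. z * x i)) \<le> cmod z * onorm (mat2_apply x)" for z x
  proof (rule onorm_bound)
    show "norm (mat2_apply (\<lambda>i. z * x i) v) \<le> cmod z * onorm (mat2_apply x) * norm v" for v
      unfolding n mult.assoc by (rule mult_left_mono[OF onorm[OF bounded_linear_mat2_apply]]) simp
  qed (simp add: onorm_pos_le[OF bounded_linear_mat2_apply])
  show ?thesis
  proof (cases "z = 0")
    case True
    then show ?thesis using le[of z x] onorm_pos_le[OF bounded_linear_mat2_apply, of "\<lambda>i. z * x i"] by simp
  next
    case False
    then have "onorm (mat2_apply x) \<le> inverse (cmod z) * onorm (mat2_apply (\<lambda>i. z * x i))"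
      using le[of "inverse z" "\<lambda>i. z * x i"] by (simp add: norm_inverse flip: mult.assoc)
    then show ?thesis using False le[of z x] by (simp add: field_simps)
  qed
qed

lemma cstar_norm_M2: "cstar_norm M2 (nrm M2)"
  unfolding cstar_norm_def M2_simps
proof (intro conjI ballI allI impI)
  note bl = bounded_linear_mat2_apply
  fix x y assume x: "x \<in> vecs M2"
  show "0 \<le> onorm (mat2_apply x)" by (rule onorm_pos_le[OF bl])
  show "onorm (mat2_apply (mul M2 (star M2 x) x)) = (onorm (mat2_apply x))\<^sup>2"
    unfolding mat2_apply_mul by (rule onorm_comp_adjoint[OF bl bl mat2_apply_adjoint])
  show "onorm (mat2_apply (\<lambda>i. z * x i)) = cmod z * onorm (mat2_apply x)" for z
    by (rule onorm_mat2_scale)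
  show "onorm (mat2_apply (mul M2 x y)) \<le> onorm (mat2_apply x) * onorm (mat2_apply y)"
    unfolding mat2_apply_mul by (rule onorm_compose[OF bl bl])
  have "mat2_apply (\<lambda>i. x i + y i) = (\<lambda>v. mat2_apply x v + mat2_apply y v)"
    by (simp add: mat2_apply_def fun_eq_iff algebra_simps)
  then show "onorm (mat2_apply (\<lambda>i. x i + y i)) \<le> onorm (mat2_apply x) + onorm (mat2_apply y)"
    using onorm_triangle[OF bl bl] by simp
  assume "onorm (mat2_apply x) = 0"
  then have "mat2_apply x v = 0" for v using onorm_eq_0[OF bl] by blast
  \<comment> \<open>The values at the two unit vectors are the columns of the matrix.\<close>
  from this[of "(1, 0)"] this[of "(0, 1)"] show "x = (\<lambda>_. 0)"
    using vecs_M2[OF x] by (simp add: mat2_apply_def zero_prod_def mat2_zero)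
qed

section \<open>Arrows of \<open>Alg\<close> and the coordinates of tensor products\<close>

lemma Ob_Alg: "A \<in> Ob Alg \<longleftrightarrow> is_star_algebra A \<and> cstar_norm A (nrm A)"
  by (simp add: Alg_def)

lemma hom_Alg:
  "f \<in> hom Alg A B \<longleftrightarrow> src f = A \<and> tgt f = B \<and> A \<in> Ob Alg \<and> B \<in> Ob Alg \<and>
     fn f \<in> star_homs A B \<and> fn f ` centre A \<subseteq> centre B \<and> fn f \<in> vecs A \<rightarrow>\<^sub>E vecs B"
  by (auto simp: hom_def Alg_def Ar_concrete_cat)

lemma M2_Ob: "M2 \<in> Ob Alg"
  by (simp add: Ob_Alg is_star_algebra_M2 cstar_norm_M2)

lemma vecs_add: "x \<in> vecs A \<Longrightarrow> y \<in> vecs A \<Longrightarrow> (\<lambda>i. x i + y i) \<in> vecs A"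
  and vecs_scale: "x \<in> vecs A \<Longrightarrow> (\<lambda>i. a * x i) \<in> vecs A"
  by (auto simp: vecs_def)

lemma star_algebraD:
  assumes "is_star_algebra A"
  shows "one A \<in> vecs A"
    and "x \<in> vecs A \<Longrightarrow> star A x \<in> vecs A"
    and "x \<in> vecs A \<Longrightarrow> mul A (one A) x = x"
    and "x \<in> vecs A \<Longrightarrow> mul A x (one A) = x"
    and "x \<in> vecs A \<Longrightarrow> y \<in> vecs A \<Longrightarrow> mul A x y \<in> vecs A"
    and "x \<in> vecs A \<Longrightarrow> y \<in> vecs A \<Longrightarrow> mul A (\<lambda>i. a * x i) y = (\<lambda>i. a * mul A x y i)"
    and "x \<in> vecs A \<Longrightarrow> y \<in> vecs A \<Longrightarrow> mul A x (\<lambda>i. a * y i) = (\<lambda>i. a * mul A x y i)"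
    and "x \<in> vecs A \<Longrightarrow> y \<in> vecs A \<Longrightarrow> z \<in> vecs A \<Longrightarrow>
           mul A (\<lambda>i. x i + y i) z = (\<lambda>i. mul A x z i + mul A y z i)"
    and "x \<in> vecs A \<Longrightarrow> y \<in> vecs A \<Longrightarrow> z \<in> vecs A \<Longrightarrow>
           mul A z (\<lambda>i. x i + y i) = (\<lambda>i. mul A z x i + mul A z y i)"
  using assms unfolding is_star_algebra_def by blast+

lemma Ide_Alg: "A \<in> Ob Alg \<Longrightarrow> Ide Alg A \<in> hom Alg A A"
proof -
  assume A: "A \<in> Ob Alg"
  then have s: "is_star_algebra A" by (simp add: Ob_Alg)
  have "Ide Alg A = Arr A (\<lambda>x\<in>vecs A. x) A" by (simp add: Alg_def)
  then show ?thesis using A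
    by (auto simp: hom_Alg star_homs_def star_algebraD[OF s] vecs_add vecs_scale centre_def)
qed

lemma star_homsD:
  assumes "f \<in> star_homs A B"
  shows "x \<in> vecs A \<Longrightarrow> f x \<in> vecs B"
    and "f (one A) = one B"
    and "x \<in> vecs A \<Longrightarrow> f (\<lambda>i. a * x i) = (\<lambda>i. a * f x i)"
    and "x \<in> vecs A \<Longrightarrow> y \<in> vecs A \<Longrightarrow> f (mul A x y) = mul B (f x) (f y)"
  using assms unfolding star_homs_def by blast+

lemma basis_in_vecs: "i < adim A \<Longrightarrow> basis i \<in> vecs A"
  by (auto simp: basis_def vecs_def)

lemma linear_expansion:
  assumes add: "\<And>x y. x \<in> vecs A \<Longrightarrow> y \<in> vecs A \<Longrightarrow> g (\<lambda>i. x i + y i) = (\<lambda>i. g x i + g y i)"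
    and scale: "\<And>a x. x \<in> vecs A \<Longrightarrow> g (\<lambda>i. a * x i) = (\<lambda>i. a * g x i)"
    and x: "x \<in> vecs A"
  shows "g x = (\<lambda>p. \<Sum>i<adim A. x i * g (basis i) p :: complex)"
proof -
  \<comment> \<open>Truncating \<open>x\<close> to its first \<open>n\<close> coordinates makes an
    induction with binary sums possible; the bound on \<open>n\<close> keeps the basis vectors in
    \<open>vecs A\<close>.\<close>
  have partial: "(\<lambda>j. if j < n then x j else 0) \<in> vecs A \<and>
      g (\<lambda>j. if j < n then x j else 0) = (\<lambda>p. \<Sum>i<n. x i * g (basis i) p)" if "n \<le> adim A" for n
    using that
  proof (induction n)
    case 0
    have "(\<lambda>_. 0) \<in> vecs A" by (simp add: vecs_def)
    \<comment> \<open>Scaling by 0 shows that \<open>g\<close> sends the zero vector to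
      zero.\<close>
    from scale[OF this, of 0] this show ?case by simp
  next
    case (Suc n)
    have b: "basis n \<in> vecs A" using Suc.prems by (simp add: basis_in_vecs)
    let ?x = "\<lambda>j. if j < n then x j else 0" and ?b = "\<lambda>j. x n * basis n j"
    have IH: "?x \<in> vecs A" "g ?x = (\<lambda>p. \<Sum>i<n. x i * g (basis i) p)" using Suc by auto
    have "(\<lambda>j. if j < Suc n then x j else 0) = (\<lambda>j. ?x j + ?b j)"
      by (auto simp: basis_def fun_eq_iff less_Suc_eq)
    moreover have "(\<lambda>j. ?x j + ?b j) \<in> vecs A" by (rule vecs_add[OF IH(1) vecs_scale[OF b]])
    moreover have "g (\<lambda>j. ?x j + ?b j) = (\<lambda>p. \<Sum>i<Suc n. x i * g (basis i) p)"
      unfolding add[OF IH(1) vecs_scale[OF b]] IH(2) scale[OF b] by simp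
    ultimately show ?case by (simp only:)
  qed
  have "(\<lambda>j. if j < adim A then x j else 0) = x" using x by (auto simp: vecs_def fun_eq_iff)
  then show ?thesis using partial[of "adim A"] by simp
qed

text \<open>Brings a product into the form of structure constants, in terms of which
  \<open>alg_tensor\<close> is defined.\<close>

lemma mul_expansion:
  assumes A: "is_star_algebra A" and x: "x \<in> vecs A" and y: "y \<in> vecs A"
  shows "mul A x y p = (\<Sum>i<adim A. \<Sum>k<adim A. x i * y k * mul A (basis i) (basis k) p)"
proof -
  note s = star_algebraD[OF A]
  have "mul A x y p = (\<Sum>i<adim A. x i * mul A (basis i) y p)"
    using linear_expansion[of A "\<lambda>x. mul A x y" x] x y s by simp
  also have "\<dots> = (\<Sum>i<adim A. x i * (\<Sum>k<adim A. y k * mul A (basis i) (basis k) p))"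
  proof (rule sum.cong[OF refl])
    fix i assume "i \<in> {..<adim A}"
    then have "basis i \<in> vecs A" by (simp add: basis_in_vecs)
    then show "x i * mul A (basis i) y p = x i * (\<Sum>k<adim A. y k * mul A (basis i) (basis k) p)"
      using linear_expansion[of A "mul A (basis i)" y] y s by simp
  qed
  finally show ?thesis by (simp add: sum_distrib_left mult_ac)
qed

lemma tensor_simps [simp]:
  "adim (tensor A B) = adim A * adim B"
  "one (tensor A B) = tensor_vec (adim A) (adim B) (one A) (one B)"
  "mul (tensor A B) = mul (alg_tensor A B)"
  by (simp_all add: tensor_def alg_tensor_def Let_def)

lemma tensor_vec_in_vecs: "tensor_vec (adim A) (adim B) x y \<in> vecs (tensor A B)"
  by (simp add: vecs_def tensor_vec_def)

lemma tensor_vec_index: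
  assumes "i < d" "j < e"
  shows "tensor_vec d e x y (i * e + j) = x i * y j"
proof -
  have "i * e + j < Suc i * e" using assms(2) by simp
  also have "\<dots> \<le> d * e" using assms(1) by (intro mult_le_mono1) simp
  finally show ?thesis using assms(2) by (simp add: tensor_vec_def)
qed

lemma tensor_mul:
  assumes A: "is_star_algebra A" and B: "is_star_algebra B"
    and x: "x \<in> vecs A" "x' \<in> vecs A" and y: "y \<in> vecs B" "y' \<in> vecs B"
  shows "mul (tensor A B) (tensor_vec (adim A) (adim B) x y) (tensor_vec (adim A) (adim B) x' y') =
    tensor_vec (adim A) (adim B) (mul A x x') (mul B y y')"
proof
  fix p
  let ?d = "adim A" and ?e = "adim B"
  let ?M = "\<lambda>i k. mul A (basis i) (basis k) (p div ?e)"
  let ?N = "\<lambda>j l. mul B (basis j) (basis l) (p mod ?e)"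
  have "mul (tensor A B) (tensor_vec ?d ?e x y) (tensor_vec ?d ?e x' y') p =
      (\<Sum>i<?d. \<Sum>j<?e. \<Sum>k<?d. \<Sum>l<?e. x i * y j * (x' k * y' l) *
        tensor_vec ?d ?e (mul A (basis i) (basis k)) (mul B (basis j) (basis l)) p)"
    by (simp add: alg_tensor_def Let_def tensor_vec_index)
  also have "\<dots> = tensor_vec ?d ?e (mul A x x') (mul B y y') p"
  proof (cases "p < ?d * ?e")
    case True
    \<comment> \<open>Exchanging the sums over \<open>j\<close> and \<open>k\<close> separates the
      indices of \<open>A\<close> from those of \<open>B\<close>, so that the fourfold sum
      factors.\<close>
    have "(\<Sum>i<?d. \<Sum>j<?e. \<Sum>k<?d. \<Sum>l<?e. x i * y j * (x' k * y' l) * (?M i k * ?N j l)) =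
        (\<Sum>i<?d. \<Sum>k<?d. \<Sum>j<?e. \<Sum>l<?e. (x i * x' k * ?M i k) * (y j * y' l * ?N j l))"
      by (rule sum.cong[OF refl], subst sum.swap) (simp add: mult_ac)
    also have "\<dots> = (\<Sum>i<?d. \<Sum>k<?d. x i * x' k * ?M i k) * (\<Sum>j<?e. \<Sum>l<?e. y j * y' l * ?N j l)"
      by (simp only: sum_distrib_right) (simp only: sum_distrib_left)
    finally show ?thesis
      using True mul_expansion[OF A x] mul_expansion[OF B y] by (simp add: tensor_vec_def)
  qed (simp add: tensor_vec_def)
  finally show "mul (tensor A B) (tensor_vec ?d ?e x y) (tensor_vec ?d ?e x' y') p =
      tensor_vec ?d ?e (mul A x x') (mul B y y') p" .
qed

lemma tensor_vec_scale:
  "tensor_vec d e (\<lambda>i. a * x i) y = (\<lambda>p. a * tensor_vec d e x y p)"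
  "tensor_vec d e x (\<lambda>i. a * y i) = (\<lambda>p. a * tensor_vec d e x y p)"
  by (auto simp: tensor_vec_def fun_eq_iff)

text \<open>The part of the structure of a unital homomorphism that excludes commuting images in \<open>M2\<close>.\<close>

definition scalar_hom :: "((nat \<Rightarrow> complex) \<Rightarrow> nat \<Rightarrow> complex) \<Rightarrow> fd_alg \<Rightarrow> fd_alg \<Rightarrow> bool" where
  "scalar_hom f A B \<longleftrightarrow> f (one A) = one B \<and>
     (\<forall>x\<in>vecs A. f x \<in> vecs B \<and> (\<forall>a. f (\<lambda>i. a * x i) = (\<lambda>i. a * f x i))) \<and>
     (\<forall>x\<in>vecs A. \<forall>y\<in>vecs A. f (mul A x y) = mul B (f x) (f y))"

text \<open>In \<open>tensor B C\<close> the elements \<open>u \<otimes> 1\<close> and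
  \<open>1 \<otimes> v\<close> commute, both products being \<open>u \<otimes> v\<close>. The two
  maps arise by applying \<open>h\<close> to \<open>f x \<otimes> 1\<close> and to
  \<open>1 \<otimes> g y\<close>.\<close>

lemma commuting_homs_from_tensor:
  assumes f: "f \<in> hom Alg A B" and g: "g \<in> hom Alg A C" and h: "h \<in> hom Alg (tensor B C) A"
  obtains \<phi> \<psi> where "scalar_hom \<phi> A A" "scalar_hom \<psi> A A"
    "\<And>x y. x \<in> vecs A \<Longrightarrow> y \<in> vecs A \<Longrightarrow> mul A (\<phi> x) (\<psi> y) = mul A (\<psi> y) (\<phi> x)"
proof -
  let ?t = "tensor_vec (adim B) (adim C)"
  define \<phi> where "\<phi> x = fn h (?t (fn f x) (one C))" for x
  define \<psi> where "\<psi> y = fn h (?t (one B) (fn g y))" for y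
  have B: "is_star_algebra B" and C: "is_star_algebra C" using f g by (auto simp: hom_Alg Ob_Alg)
  note s = star_algebraD[OF B] star_algebraD[OF C]
  have fh: "fn f \<in> star_homs A B" and gh: "fn g \<in> star_homs A C" and hh: "fn h \<in> star_homs (tensor B C) A"
    using f g h by (auto simp: hom_Alg)
  have hm: "fn h (?t (mul B x x') (mul C y y')) = mul A (fn h (?t x y)) (fn h (?t x' y'))"
    if "x \<in> vecs B" "x' \<in> vecs B" "y \<in> vecs C" "y' \<in> vecs C" for x x' y y'
    using star_homsD(4)[OF hh tensor_vec_in_vecs tensor_vec_in_vecs, of x y x' y'] tensor_mul[OF B C that] by simp
  have "scalar_hom \<phi> A A" "scalar_hom \<psi> A A"
    using hm[of _ _ "one C" "one C"] hm[of "one B" "one B"] star_homsD(2)[OF hh]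
    by (simp_all add: scalar_hom_def \<phi>_def \<psi>_def star_homsD[OF fh] star_homsD[OF gh] s
        star_homsD(1,3)[OF hh tensor_vec_in_vecs] tensor_vec_scale)
  moreover have "mul A (\<phi> x) (\<psi> y) = mul A (\<psi> y) (\<phi> x)" if "x \<in> vecs A" "y \<in> vecs A" for x y
    unfolding \<phi>_def \<psi>_def
    using hm[of "fn f x" "one B" "one C" "fn g y"] hm[of "one B" "fn f x" "fn g y" "one C"] that
    by (simp add: star_homsD[OF fh] star_homsD[OF gh] s)
  ultimately show ?thesis using that by blast
qed

section \<open>Commuting images in 2 x 2 matrices\<close>

text \<open>The matrix \<open>F\<close> is not scalar, so its centralizer is spanned by 1 and
  \<open>F\<close>. In coordinates: commuting matrices have proportional triples (upper right entry,
  lower left entry, difference of the diagonal entries), and the triple of \<open>F\<close> is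
  nonzero.\<close>

lemma M2_centralizer_commutative:
  assumes v: "F \<in> vecs M2" "F' \<in> vecs M2" "G \<in> vecs M2" "G' \<in> vecs M2"
    and ne: "mul M2 F F' \<noteq> mul M2 F' F"
    and c: "mul M2 F G = mul M2 G F" "mul M2 F G' = mul M2 G' F"
  shows "mul M2 G G' = mul M2 G' G"
proof -
  obtain a b c d where F: "F = mat2 a b c d" by (rule vecs_M2_cases[OF v(1)])
  obtain a' b' c' d' where F': "F' = mat2 a' b' c' d'" by (rule vecs_M2_cases[OF v(2)])
  obtain p q r s where G: "G = mat2 p q r s" by (rule vecs_M2_cases[OF v(3)])
  obtain p' q' r' s' where G': "G' = mat2 p' q' r' s'" by (rule vecs_M2_cases[OF v(4)])
  have eqs: "b * r = q * c" "a * q + b * s = p * b + q * d" "c * p + d * r = r * a + s * c"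
    "b * r' = q' * c" "a * q' + b * s' = p' * b + q' * d" "c * p' + d * r' = r' * a + s' * c"
    using \<open>mul M2 F G = mul M2 G F\<close> \<open>mul M2 F G' = mul M2 G' F\<close> by (auto simp: F G G')
  have "b \<noteq> 0 \<or> c \<noteq> 0 \<or> a - d \<noteq> 0" using ne by (auto simp: F F' mult.commute)
  \<comment> \<open>The three differences are the minors of the triples of \<open>G\<close> and
    \<open>G'\<close>; they vanish exactly when \<open>G\<close> and \<open>G'\<close> commute.
    Multiplied by an entry of the triple of \<open>F\<close> they follow from \<open>eqs\<close>,
    and a nonzero entry is then cancelled.\<close>
  moreover have "k * (q * r' - q' * r) = 0 \<and> k * (q * (s' - p') - q' * (s - p)) = 0 \<and>
      k * (r * (s' - p') - r' * (s - p)) = 0" if "k \<in> {b, c, a - d}" for k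
    using that
  proof (elim insertE emptyE)
    assume k: "k = b"
    show ?thesis unfolding k by (intro conjI; use eqs in algebra)
  next
    assume k: "k = c"
    show ?thesis unfolding k by (intro conjI; use eqs in algebra)
  next
    assume k: "k = a - d"
    show ?thesis unfolding k by (intro conjI; use eqs in algebra)
  qed
  ultimately have "q * r' - q' * r = 0 \<and> q * (s' - p') - q' * (s - p) = 0 \<and> r * (s' - p') - r' * (s - p) = 0"
    by (metis insert_iff mult_eq_0_iff)
  then show ?thesis by (simp add: G G' algebra_simps)
qed

lemma M2_hom_noncommutative:
  assumes "scalar_hom \<phi> M2 M2"
  obtains x y where "x \<in> vecs M2" "y \<in> vecs M2" "mul M2 (\<phi> x) (\<phi> y) \<noteq> mul M2 (\<phi> y) (\<phi> x)"
proof
  \<comment> \<open>If the images of these anticommuting involutions commute, then their product is zero.\<close>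
  let ?x = "mat2 0 1 1 0" and ?y = "mat2 1 0 0 (-1)"
  note h = assms[unfolded scalar_hom_def]
  show "mul M2 (\<phi> ?x) (\<phi> ?y) \<noteq> mul M2 (\<phi> ?y) (\<phi> ?x)"
  proof
    assume "mul M2 (\<phi> ?x) (\<phi> ?y) = mul M2 (\<phi> ?y) (\<phi> ?x)"
    then have "\<phi> (mul M2 ?x ?y) = \<phi> (mul M2 ?y ?x)" using h by (metis mat2_in_vecs)
    then have 1: "\<phi> (mat2 0 (-1) 1 0) = \<phi> (mat2 0 1 (-1) 0)" by simp
    have "\<phi> (\<lambda>i. (-1) * mat2 0 1 (-1) 0 i) = (\<lambda>i. (-1) * \<phi> (mat2 0 1 (-1) 0) i)"
      using h mat2_in_vecs by blast
    then have 2: "\<phi> (mat2 0 (-1) 1 0) = (\<lambda>i. - \<phi> (mat2 0 (-1) 1 0) i)"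
      unfolding mat2_ops by (simp add: 1)
    have "z = 0" if "z = - z" for z :: complex using that by (simp add: complex_eq_iff)
    then have "\<phi> (mat2 0 (-1) 1 0) i = 0" for i using fun_cong[OF 2, of i] by blast
    then have 3: "\<phi> (mat2 0 (-1) 1 0) = mat2 0 0 0 0" by (simp add: mat2_zero fun_eq_iff)
    \<comment> \<open>The factors are \<open>xy\<close> and \<open>yx\<close> for the two
      involutions, with product \<open>x y y x = 1\<close>. A unital multiplicative map cannot send
      the first factor to zero.\<close>
    have "mul M2 (mat2 0 (-1) 1 0) (mat2 0 1 (-1) 0) = one M2" by simp
    then have "mul M2 (\<phi> (mat2 0 (-1) 1 0)) (\<phi> (mat2 0 1 (-1) 0)) = one M2"
      using h by (metis mat2_in_vecs)
    then show False unfolding 1[symmetric] 3 by simp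
  qed
qed simp_all

text \<open>The image of \<open>\<phi>\<close> contains a noncommuting pair, and the image of
  \<open>\<psi>\<close> centralizes one member of it. So the image of \<open>\<psi>\<close> would be
  commutative, which \<open>M2_hom_noncommutative\<close> excludes.\<close>

lemma no_commuting_M2_homs:
  assumes \<phi>: "scalar_hom \<phi> M2 M2" and \<psi>: "scalar_hom \<psi> M2 M2"
    and c: "\<And>x y. x \<in> vecs M2 \<Longrightarrow> y \<in> vecs M2 \<Longrightarrow> mul M2 (\<phi> x) (\<psi> y) = mul M2 (\<psi> y) (\<phi> x)"
  shows False
proof -
  obtain x x' where x: "x \<in> vecs M2" "x' \<in> vecs M2" "mul M2 (\<phi> x) (\<phi> x') \<noteq> mul M2 (\<phi> x') (\<phi> x)"
    using M2_hom_noncommutative[OF \<phi>] by blast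
  obtain y y' where y: "y \<in> vecs M2" "y' \<in> vecs M2" "mul M2 (\<psi> y) (\<psi> y') \<noteq> mul M2 (\<psi> y') (\<psi> y)"
    using M2_hom_noncommutative[OF \<psi>] by blast
  have "mul M2 (\<psi> y) (\<psi> y') = mul M2 (\<psi> y') (\<psi> y)"
    by (rule M2_centralizer_commutative[OF _ _ _ _ x(3)])
       (use \<phi> \<psi> x y c in \<open>auto simp: scalar_hom_def\<close>)
  with y show False by blast
qed

section \<open>Vertices of representables and of their Day convolution\<close>

lemma simplices_yo: "simplices (yo A) B U n = AlgArr ` hom Alg A B"
  by (simp add: simplices_def yo_def mk_hq_def Let_def)

lemma inhabited_yo: "A \<in> Ob Alg \<Longrightarrow> inhabited (obj_of (yo A) A)"
  using Ide_Alg[of A] simplices_yo[of A A "[0]" 0] unfolding inhabited_def simplices_def by blast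

text \<open>In dimension 0 both chains of the bar construction are single objects, so the objects
  carrying the two elements of the representables are those whose tensor product is the source of
  \<open>h\<close>.\<close>

lemma inhabited_day_yo:
  assumes "inhabited (obj_of (day (yo A) (yo A)) A)"
  obtains f g h B C where "f \<in> hom Alg A B" "g \<in> hom Alg A C" "h \<in> hom Alg (tensor B C) A"
proof -
  from assms obtain b c h x y where "h \<in> hom Alg (tensor (vertex b 0) (vertex c 0)) A"
      "x \<in> simplices (yo A) (vertex b 0) [0] 0" "y \<in> simplices (yo A) (vertex c 0) [0] 0"
    by (auto simp: inhabited_def day_def mk_hq_def Let_def)
  with that show ?thesis by (auto simp: simplices_yo)
qed

theorem theorem10p1:
  shows "\<not> (\<exists>c.
    (\<forall>A\<in>Ob Alg. c A \<in> hom HQ (yo A) (day (yo A) (yo A))) \<and>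
    (\<forall>A\<in>Ob Alg. \<forall>B\<in>Ob Alg. \<forall>f\<in>hom Alg A B.
       Comp HQ (HQ_arr (day_map (yo_map f) (yo_map f))) (c B) = Comp HQ (c A) (HQ_arr (yo_map f))))"
proof
  assume "\<exists>c. (\<forall>A\<in>Ob Alg. c A \<in> hom HQ (yo A) (day (yo A) (yo A))) \<and>
    (\<forall>A\<in>Ob Alg. \<forall>B\<in>Ob Alg. \<forall>f\<in>hom Alg A B.
       Comp HQ (HQ_arr (day_map (yo_map f) (yo_map f))) (c B) = Comp HQ (c A) (HQ_arr (yo_map f)))"
  then obtain k where "k \<in> hom HQ (yo M2) (day (yo M2) (yo M2))" using M2_Ob by blast
  then have "inhabited (obj_of (day (yo M2) (yo M2)) M2)"
    by (rule hom_HQ_inhabited[OF _ M2_Ob inhabited_yo[OF M2_Ob]])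
  then obtain f g h B C where "f \<in> hom Alg M2 B" "g \<in> hom Alg M2 C" "h \<in> hom Alg (tensor B C) M2"
    by (rule inhabited_day_yo)
  then show False
    by (rule commuting_homs_from_tensor) (use no_commuting_M2_homs in blast)
qed

end
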